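(* Let $\mu,\lambda\in\mathbb{R}$ and let $H_{\mu\lambda}$ be the self-adjoint operator on $L^{2,e}(\mathbb{T},d\nu)$ defined in the context, whose essential spectrum is $[0,2]$. Let $\mathbb{G}_{j,\pm}$ $(j=0,1,2)$ be the subsets of the $(\mu,\lambda)$-plane $\mathbb{R}^2$ defined in the context and put $$\mathrm{G}_{02}=\mathbb{G}_{0,-}\cap\mathbb{G}_{2,+},\quad \mathrm{G}_{01}=\mathbb{G}_{0,-}\cap\mathbb{G}_{1,+},\quad \mathrm{G}_{11}=\mathbb{G}_{1,-}\cap\mathbb{G}_{1,+},\quad \mathrm{G}_{10}=\mathbb{G}_{1,-}\cap\mathbb{G}_{0,+},\quad \mathrm{G}_{20}=\mathbb{G}_{2,-}\cap\mathbb{G}_{0,+}.$$ Then the following hold. (i) If $(\mu,\lambda)\in \mathrm{G}_{02}$, then $H_{\mu\lambda}$ has no eigenvalue below the essential spectrum, and it has exactly two eigenvalues $\zeta_1(\mu,\lambda)$ and $\zeta_2(\mu,\lambda)$ outside the essential spectrum, which satisfy $$2<\zeta_1(\mu,\lambda)<\zeta_{\min}(\mu,\lambda)\leq\zeta_{\max}(\mu,\lambda)<\zeta_2(\mu,\lambda).$$ (ii) If $(\mu,\lambda)\in \mathrm{G}_{01}$, then $H_{\mu\lambda}$ has no eigenvalue below the essential spectrum, and it has exactly one eigenvalue $\zeta_2(\mu,\lambda)$ outside the essential spectrum, which satisfies $\zeta_2(\mu,\lambda)>2$. (iii) If $(\mu,\lambda)\in \mathrm{G}_{11}$, then $H_{\mu\lambda}$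 has exactly two eigenvalues $\zeta_1(\mu,\lambda)$ and $\zeta_2(\mu,\lambda)$ outside the essential spectrum, which satisfy $\zeta_1(\mu,\lambda)<0$ and $\zeta_2(\mu,\lambda)>2$. (iv) If $(\mu,\lambda)\in \mathrm{G}_{10}$, then $H_{\mu\lambda}$ has exactly one eigenvalue $\zeta_1(\mu,\lambda)$ outside the essential spectrum, which satisfies $\zeta_1(\mu,\lambda)<0$, and it has no eigenvalue above the essential spectrum. (v) If $(\mu,\lambda)\in \mathrm{G}_{20}$, then $H_{\mu\lambda}$ has exactly two eigenvalues $\zeta_1(\mu,\lambda)$ and $\zeta_2(\mu,\lambda)$ outside the essential spectrum, which satisfy $$\zeta_1(\mu,\lambda)<\zeta_{\min}(\mu,\lambda)\leq\zeta_{\max}(\mu,\lambda)<\zeta_2(\mu,\lambda)<0,$$ and it has no eigenvalue above the essential spectrum.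
   Context: $\mathbb{T}=(-\pi,\pi]$ is the one-dimensional torus with normalized Haar measure $d\nu(p)=\frac{dp}{2\pi}$, and $L^{2,e}(\mathbb{T},d\nu)$ is the Hilbert space of (complex-valued) square-integrable functions $f$ on $\mathbb{T}$ that are even: $f(p)=f(-p)$ for a.e. $p$. For $\mu,\lambda\in\mathbb{R}$, the bounded self-adjoint operator $H_{\mu\lambda}$ on $L^{2,e}(\mathbb{T},d\nu)$ is $H_{\mu\lambda}=H_0+V_{\mu\lambda}$, where $$(H_0f)(p)=\varepsilon(p)f(p),\quad \varepsilon(p)=1-\cos p,\qquad (V_{\mu\lambda}f)(p)=\int_{\mathbb{T}}\big(\mu+\lambda\cos p\cos t\big)f(t)\,d\nu(t).$$ The essential spectrum of $H_{\mu\lambda}$ is $[0,2]$ for all $\mu,\lambda$; "below" (resp. "above") the essential spectrum means in $(-\infty,0)$ (resp. $(2,+\infty)$). For $\mu\ne0$ (resp. $\lambda\neq 0$), $\zeta(\mu)$ (resp. $\zeta(\lambda)$) denotes the unique eigenvalue of $H_{\mu 0}$ (resp. $H_{0\lambda}$) outside $[0,2]$, where $H_{\mu0}$ is the operator with $\lambda=0$ and $H_{0\lambda}$ is the operator with $\mu=0$. (The two functions $\mu\mapsto\zeta(\mu)$ and $\lambda\mapsto\zeta(\lambda)$ are different functions.) Put $\zeta_{\min}(\mu,\lambda)=\min\{\zeta(\mu),\zeta(\lambda)\}$ and $\zeta_{\max}(\mu,\lambda)=\max\{\zeta(\mu),\zeta(\lambda)\}$. Let $C^{+}_{-\frac12}(\mu,\lambda)=B_2(\mu\lambda-\mu-\lambda)$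 and $C^{-}_{-\frac12}(\mu,\lambda)=B_0(\mu\lambda+\mu+\lambda)$, where $B_2,B_0>0$ are constants (only the signs of $C^{\pm}_{-\frac12}$ matter). Define $$\mathbb{G}_{2,+}=\{(\mu,\lambda)\in\mathbb{R}^2:\ C^{+}_{-\frac12}(\mu,\lambda)>0,\ \mu>1\},$$ $$\mathbb{G}_{1,+}=\{(\mu,\lambda)\in\mathbb{R}^2:\ (C^{+}_{-\frac12}(\mu,\lambda)=0 \text{ and } \mu>1)\ \text{or}\ C^{+}_{-\frac12}(\mu,\lambda)<0\},$$ $$\mathbb{G}_{0,+}=\{(\mu,\lambda)\in\mathbb{R}^2:\ (C^{+}_{-\frac12}(\mu,\lambda)=0 \text{ and } \mu<1)\ \text{or}\ C^{+}_{-\frac12}(\mu,\lambda)>0\},$$ $$\mathbb{G}_{2,-}=\{(\mu,\lambda)\in\mathbb{R}^2:\ C^{-}_{-\frac12}(\mu,\lambda)>0,\ \mu<-1\},$$ $$\mathbb{G}_{1,-}=\{(\mu,\lambda)\in\mathbb{R}^2:\ (C^{-}_{-\frac12}(\mu,\lambda)=0 \text{ and } \mu<-1)\ \text{or}\ C^{-}_{-\frac12}(\mu,\lambda)<0\},$$ $$\mathbb{G}_{0,-}=\{(\mu,\lambda)\in\mathbb{R}^2:\ (C^{-}_{-\frac12}(\mu,\lambda)=0 \text{ and } \mu>-1)\ \text{or}\ C^{-}_{-\frac12}(\mu,\lambda)>0\}.$$ *)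

theory Defs
  imports "HOL-Analysis.Analysis"
begin

text \<open>Elements of \<open>L\<^sup>2\<close> are represented by functions up to equality almost everywhere; functions are
  considered on the fundamental domain \<open>{-pi<..pi}\<close> of the torus.\<close>

definition haar_torus :: "real measure" where
  "haar_torus = scale_measure (ennreal (1 / (2 * pi))) (restrict_space lborel {-pi<..pi})"

definition L2_even :: "(real \<Rightarrow> complex) set" where
  "L2_even = {f. f \<in> borel_measurable haar_torus \<and>
                 integrable haar_torus (\<lambda>p. (cmod (f p))\<^sup>2) \<and>
                 (AE p in haar_torus. f p = f (- p))}"

definition L2_inner :: "(real \<Rightarrow> complex) \<Rightarrow> (real \<Rightarrow> complex) \<Rightarrow> complex" where
  "L2_inner f g = (LINT p|haar_torus. f p * cnj (g p))"

definition dispersion :: "real \<Rightarrow> real" where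
  "dispersion p = 1 - cos p"

definition H_free :: "(real \<Rightarrow> complex) \<Rightarrow> real \<Rightarrow> complex" where
  "H_free f p = complex_of_real (dispersion p) * f p"

definition V_pot :: "real \<Rightarrow> real \<Rightarrow> (real \<Rightarrow> complex) \<Rightarrow> real \<Rightarrow> complex" where
  "V_pot \<mu> lam f p = (LINT t|haar_torus. complex_of_real (\<mu> + lam * cos p * cos t) * f t)"

definition H_op :: "real \<Rightarrow> real \<Rightarrow> (real \<Rightarrow> complex) \<Rightarrow> real \<Rightarrow> complex" where
  "H_op \<mu> lam f p = H_free f p + V_pot \<mu> lam f p"

text \<open>\<open>H_op \<mu> lam\<close> descends to a symmetric operator on the equivalence classes of \<open>L2_even\<close>.\<close>

lemma emeasure_haar_torus: "emeasure haar_torus (space haar_torus) = 1"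
proof -
  have "emeasure haar_torus (space haar_torus) = ennreal (1 / (2 * pi)) * ennreal (2 * pi)"
    by (simp add: haar_torus_def space_scale_measure space_restrict_space emeasure_restrict_space)
  also have "\<dots> = 1"
    by (subst ennreal_mult[symmetric]) auto
  finally show ?thesis .
qed

lemma finite_measure_haar_torus: "finite_measure haar_torus"
  by (rule finite_measureI) (simp add: emeasure_haar_torus)

lemma cos_measurable_haar [measurable]: "cos \<in> borel_measurable haar_torus"
proof -
  have "cos \<in> borel_measurable (restrict_space lborel {-pi<..pi})"
    by (intro measurable_restrict_space1) simp
  then show ?thesis by (simp add: haar_torus_def)
qed

lemma L2_even_measurable: "f \<in> L2_even \<Longrightarrow> f \<in> borel_measurable haar_torus"
  by (simp add: L2_even_def)

lemma L2_even_prod_integrable: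
  assumes "f \<in> L2_even" "g \<in> L2_even" and [measurable]: "c \<in> borel_measurable haar_torus"
    and c: "\<And>p. \<bar>c p\<bar> \<le> K"
  shows "integrable haar_torus (\<lambda>p. complex_of_real (c p) * f p * cnj (g p))"
proof (rule Bochner_Integration.integrable_bound)
  have [measurable]: "f \<in> borel_measurable haar_torus" "g \<in> borel_measurable haar_torus"
    using assms by (simp_all add: L2_even_def)
  show "integrable haar_torus (\<lambda>p. K * ((cmod (f p))\<^sup>2 + (cmod (g p))\<^sup>2))"
    using assms by (simp add: L2_even_def)
  show "(\<lambda>p. complex_of_real (c p) * f p * cnj (g p)) \<in> borel_measurable haar_torus"
    using measurable_compose[OF L2_even_measurable[OF assms(2)] borel_measurable_continuous_onI[of cnj]]
    by (auto intro: continuous_intros)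
  have K: "0 \<le> K" using c[of 0] by linarith
  have "cmod (f p) * cmod (g p) \<le> (cmod (f p))\<^sup>2 + (cmod (g p))\<^sup>2" for p
    using sum_squares_bound[of "cmod (f p)" "cmod (g p)"]
      mult_nonneg_nonneg[OF norm_ge_zero[of "f p"] norm_ge_zero[of "g p"]] by linarith
  then show "AE p in haar_torus. norm (complex_of_real (c p) * f p * cnj (g p))
      \<le> norm (K * ((cmod (f p))\<^sup>2 + (cmod (g p))\<^sup>2))"
    using c K by (intro AE_I2) (auto simp: norm_mult abs_mult mult.assoc intro!: mult_mono)
qed

lemma L2_even_one: "(\<lambda>_. 1) \<in> L2_even"
  using finite_measure_haar_torus
  by (auto simp: L2_even_def intro!: finite_measure.integrable_const)

lemma L2_even_integrable:
  assumes "f \<in> L2_even"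
  shows "integrable haar_torus f" "integrable haar_torus (\<lambda>t. complex_of_real (cos t) * f t)"
  using L2_even_prod_integrable[OF assms L2_even_one, of "\<lambda>_. 1" 1]
    L2_even_prod_integrable[OF assms L2_even_one, of cos 1] by simp_all

lemma V_pot_eq:
  assumes "f \<in> L2_even"
  shows "V_pot \<mu> lam f p = \<mu> * (LINT t|haar_torus. f t) +
           complex_of_real (lam * cos p) * (LINT t|haar_torus. complex_of_real (cos t) * f t)"
proof -
  have "V_pot \<mu> lam f p = (LINT t|haar_torus. complex_of_real \<mu> * f t +
          complex_of_real (lam * cos p) * (complex_of_real (cos t) * f t))"
    by (simp add: V_pot_def algebra_simps)
  then show ?thesis
    using L2_even_integrable[OF assms] by simp
qed

lemma H_op_cong_AE:
  assumes "f \<in> L2_even" "g \<in> L2_even" "AE p in haar_torus. f p = g p"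
  shows "AE p in haar_torus. H_op \<mu> lam f p = H_op \<mu> lam g p"
proof -
  have [measurable]: "f \<in> borel_measurable haar_torus" "g \<in> borel_measurable haar_torus"
    using assms by (simp_all add: L2_even_def)
  have "V_pot \<mu> lam f p = V_pot \<mu> lam g p" for p
    unfolding V_pot_def using assms(3) by (intro integral_cong_AE) auto
  then show ?thesis using assms(3) by (auto simp: H_op_def H_free_def)
qed

lemma H_op_L2_even:
  assumes "f \<in> L2_even"
  shows "H_op \<mu> lam f \<in> L2_even"
proof -
  have [measurable]: "f \<in> borel_measurable haar_torus"
    using assms by (simp add: L2_even_def)
  define a where "a = (LINT t|haar_torus. f t)"
  define b where "b = (LINT t|haar_torus. complex_of_real (cos t) * f t)"
  define M where "M = \<bar>\<mu>\<bar> * cmod a + \<bar>lam\<bar> * cmod b"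
  have eq: "H_op \<mu> lam f = (\<lambda>p. complex_of_real (1 - cos p) * f p + (\<mu> * a + complex_of_real (lam * cos p) * b))"
    by (simp add: fun_eq_iff H_op_def H_free_def dispersion_def V_pot_eq[OF assms] a_def b_def)
  have [measurable]: "H_op \<mu> lam f \<in> borel_measurable haar_torus"
    unfolding eq by measurable
  have "cmod (H_op \<mu> lam f p) \<le> 2 * cmod (f p) + M" for p
  proof -
    have "\<bar>1 - cos p\<bar> \<le> 2" "\<bar>cos p\<bar> \<le> 1" using cos_le_one[of p] cos_ge_minus_one[of p] by linarith+
    then have "cmod (complex_of_real (1 - cos p) * f p) \<le> 2 * cmod (f p)"
      "cmod (complex_of_real (lam * cos p) * b) \<le> \<bar>lam\<bar> * cmod b"
      by (simp_all only: norm_mult norm_of_real abs_mult)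
        (auto intro!: mult_right_mono mult_left_le)
    moreover have "cmod (\<mu> * a) = \<bar>\<mu>\<bar> * cmod a" by (simp add: norm_mult)
    ultimately show ?thesis unfolding eq M_def
      using norm_triangle_ineq[of "complex_of_real (1 - cos p) * f p" "\<mu> * a + complex_of_real (lam * cos p) * b"]
        norm_triangle_ineq[of "\<mu> * a" "complex_of_real (lam * cos p) * b"] by linarith
  qed
  then have "(cmod (H_op \<mu> lam f p))\<^sup>2 \<le> (2 * cmod (f p) + M)\<^sup>2" for p
    by (intro power_mono) auto
  moreover have "(2 * x + M)\<^sup>2 \<le> 8 * x\<^sup>2 + 2 * M\<^sup>2" for x :: real
    using zero_le_power2[of "2 * x - M"] by (simp add: power2_eq_square algebra_simps)
  ultimately have bound: "(cmod (H_op \<mu> lam f p))\<^sup>2 \<le> 8 * (cmod (f p))\<^sup>2 + 2 * M\<^sup>2" for p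
    by (meson order_trans)
  have "integrable haar_torus (\<lambda>p. 8 * (cmod (f p))\<^sup>2 + 2 * M\<^sup>2)"
    using assms finite_measure_haar_torus
    by (auto simp: L2_even_def intro!: finite_measure.integrable_const)
  then have "integrable haar_torus (\<lambda>p. (cmod (H_op \<mu> lam f p))\<^sup>2)"
    by (rule Bochner_Integration.integrable_bound) (use bound in \<open>auto simp: abs_of_nonneg\<close>)
  moreover have "AE p in haar_torus. H_op \<mu> lam f p = H_op \<mu> lam f (- p)"
    using assms by (auto simp: eq L2_even_def)
  ultimately show ?thesis by (simp add: L2_even_def)
qed

lemma H_op_selfadjoint:
  assumes f: "f \<in> L2_even" and g: "g \<in> L2_even"
  shows "L2_inner (H_op \<mu> lam f) g = L2_inner f (H_op \<mu> lam g)"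
proof -
  define a where "a h = (LINT t|haar_torus. h t)" for h :: "real \<Rightarrow> complex"
  define b where "b h = (LINT t|haar_torus. complex_of_real (cos t) * h t)" for h :: "real \<Rightarrow> complex"
  have eq: "H_op \<mu> lam h p = complex_of_real (1 - cos p) * h p + (\<mu> * a h + complex_of_real (lam * cos p) * b h)"
    if "h \<in> L2_even" for h p
    by (simp add: H_op_def H_free_def dispersion_def V_pot_eq[OF that] a_def b_def)
  have "\<bar>1 - cos p\<bar> \<le> 2" for p :: real
    using cos_le_one[of p] cos_ge_minus_one[of p] by linarith
  then have i: "integrable haar_torus (\<lambda>p. complex_of_real (1 - cos p) * f p * cnj (g p))"
    by (intro L2_even_prod_integrable[OF f g, where K = 2]) auto
  note f' = L2_even_integrable[OF f] and g' = L2_even_integrable[OF g]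
  have cg: "integrable haar_torus (\<lambda>t. cnj (g t))"
    "integrable haar_torus (\<lambda>t. complex_of_real (cos t) * cnj (g t))"
    using g'[THEN integrable_cnj] by simp_all
  have ca: "(LINT t|haar_torus. cnj (g t)) = cnj (a g)"
    "(LINT t|haar_torus. complex_of_real (cos t) * cnj (g t)) = cnj (b g)"
    using Bochner_Integration.integral_cnj[of haar_torus g] Bochner_Integration.integral_cnj[of haar_torus "\<lambda>t. complex_of_real (cos t) * g t"]
    by (simp_all add: a_def b_def)
  let ?I = "LINT p|haar_torus. complex_of_real (1 - cos p) * f p * cnj (g p)"
  have "L2_inner (H_op \<mu> lam f) g = (LINT p|haar_torus. complex_of_real (1 - cos p) * f p * cnj (g p)
      + ((\<mu> * a f) * cnj (g p) + (lam * b f) * (complex_of_real (cos p) * cnj (g p))))"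
    unfolding L2_inner_def
    by (intro Bochner_Integration.integral_cong refl) (simp add: eq[OF f] algebra_simps)
  also have "\<dots> = ?I + (\<mu> * a f * cnj (a g) + lam * b f * cnj (b g))"
    using i cg
    by (subst Bochner_Integration.integral_add; (subst Bochner_Integration.integral_add)?)
      (auto simp: ca a_def)
  finally have 1: "L2_inner (H_op \<mu> lam f) g = ?I + (\<mu> * a f * cnj (a g) + lam * b f * cnj (b g))" .
  have "L2_inner f (H_op \<mu> lam g) = (LINT p|haar_torus. complex_of_real (1 - cos p) * f p * cnj (g p)
      + ((\<mu> * cnj (a g)) * f p + (lam * cnj (b g)) * (complex_of_real (cos p) * f p)))"
    unfolding L2_inner_def
    by (intro Bochner_Integration.integral_cong refl) (simp add: eq[OF g] algebra_simps)
  also have "\<dots> = ?I + (\<mu> * cnj (a g) * a f + lam * cnj (b g) * b f)"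
    using i f'
    by (subst Bochner_Integration.integral_add; (subst Bochner_Integration.integral_add)?)
      (auto simp: a_def b_def)
  finally show ?thesis using 1 by (simp add: mult_ac)
qed

definition is_eigenvalue :: "((real \<Rightarrow> complex) \<Rightarrow> real \<Rightarrow> complex) \<Rightarrow> complex \<Rightarrow> bool" where
  "is_eigenvalue A z \<longleftrightarrow>
     (\<exists>f\<in>L2_even. \<not> (AE p in haar_torus. f p = 0) \<and> (AE p in haar_torus. A f p = z * f p))"

text \<open>``Outside'', ``below'' and ``above'' refer to the interval \<open>[0, 2]\<close>, the essential spectrum of
  \<open>H_op \<mu> lam\<close> for all parameters. Eigenvalues are not assumed to be real.\<close>

definition eigenvalues_outside :: "((real \<Rightarrow> complex) \<Rightarrow> real \<Rightarrow> complex) \<Rightarrow> complex set" where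
  "eigenvalues_outside A = {z. is_eigenvalue A z \<and> z \<notin> complex_of_real ` {0..2}}"

definition eigenvalues_below :: "((real \<Rightarrow> complex) \<Rightarrow> real \<Rightarrow> complex) \<Rightarrow> complex set" where
  "eigenvalues_below A = {z. is_eigenvalue A z \<and> z \<in> complex_of_real ` {..<0}}"

definition eigenvalues_above :: "((real \<Rightarrow> complex) \<Rightarrow> real \<Rightarrow> complex) \<Rightarrow> complex set" where
  "eigenvalues_above A = {z. is_eigenvalue A z \<and> z \<in> complex_of_real ` {2<..}}"

text \<open>The next two are only meaningful for a nonzero parameter, where the eigenvalue described
  exists and is unique.\<close>

definition zeta_mu :: "real \<Rightarrow> real" where
  "zeta_mu \<mu> = (THE x. complex_of_real x \<in> eigenvalues_outside (H_op \<mu> 0))"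

definition zeta_lambda :: "real \<Rightarrow> real" where
  "zeta_lambda lam = (THE x. complex_of_real x \<in> eigenvalues_outside (H_op 0 lam))"

definition zeta_min :: "real \<Rightarrow> real \<Rightarrow> real" where
  "zeta_min \<mu> lam = min (zeta_mu \<mu>) (zeta_lambda lam)"

definition zeta_max :: "real \<Rightarrow> real \<Rightarrow> real" where
  "zeta_max \<mu> lam = max (zeta_mu \<mu>) (zeta_lambda lam)"

text \<open>\<open>B0\<close> and \<open>B2\<close> are positive constants; only the signs of \<open>C_minus\<close> and \<open>C_plus\<close> matter.\<close>

definition C_plus :: "real \<Rightarrow> real \<Rightarrow> real \<Rightarrow> real" where
  "C_plus B2 \<mu> lam = B2 * (\<mu> * lam - \<mu> - lam)"

definition C_minus :: "real \<Rightarrow> real \<Rightarrow> real \<Rightarrow> real" where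
  "C_minus B0 \<mu> lam = B0 * (\<mu> * lam + \<mu> + lam)"

definition G2_plus :: "real \<Rightarrow> (real \<times> real) set" where
  "G2_plus B2 = {(\<mu>, lam). C_plus B2 \<mu> lam > 0 \<and> \<mu> > 1}"

definition G1_plus :: "real \<Rightarrow> (real \<times> real) set" where
  "G1_plus B2 = {(\<mu>, lam). (C_plus B2 \<mu> lam = 0 \<and> \<mu> > 1) \<or> C_plus B2 \<mu> lam < 0}"

definition G0_plus :: "real \<Rightarrow> (real \<times> real) set" where
  "G0_plus B2 = {(\<mu>, lam). (C_plus B2 \<mu> lam = 0 \<and> \<mu> < 1) \<or> C_plus B2 \<mu> lam > 0}"

definition G2_minus :: "real \<Rightarrow> (real \<times> real) set" where
  "G2_minus B0 = {(\<mu>, lam). C_minus B0 \<mu> lam > 0 \<and> \<mu> < -1}"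

definition G1_minus :: "real \<Rightarrow> (real \<times> real) set" where
  "G1_minus B0 = {(\<mu>, lam). (C_minus B0 \<mu> lam = 0 \<and> \<mu> < -1) \<or> C_minus B0 \<mu> lam < 0}"

definition G0_minus :: "real \<Rightarrow> (real \<times> real) set" where
  "G0_minus B0 = {(\<mu>, lam). (C_minus B0 \<mu> lam = 0 \<and> \<mu> > -1) \<or> C_minus B0 \<mu> lam > 0}"

definition G02 :: "real \<Rightarrow> real \<Rightarrow> (real \<times> real) set" where
  "G02 B0 B2 = G0_minus B0 \<inter> G2_plus B2"

definition G01 :: "real \<Rightarrow> real \<Rightarrow> (real \<times> real) set" where
  "G01 B0 B2 = G0_minus B0 \<inter> G1_plus B2"

definition G11 :: "real \<Rightarrow> real \<Rightarrow> (real \<times> real) set" where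
  "G11 B0 B2 = G1_minus B0 \<inter> G1_plus B2"

definition G10 :: "real \<Rightarrow> real \<Rightarrow> (real \<times> real) set" where
  "G10 B0 B2 = G1_minus B0 \<inter> G0_plus B2"

definition G20 :: "real \<Rightarrow> real \<Rightarrow> (real \<times> real) set" where
  "G20 B0 B2 = G2_minus B0 \<inter> G0_plus B2"

end

theory Submission
  imports Defs
begin

text \<open>Write a point outside \<open>[0, 2]\<close> as \<open>z = 1 - (x + 1 / x) / 2\<close> with \<open>0 < \<bar>x\<bar> < 1\<close>. Then
  \<open>1 / (1 - cos p - z)\<close> is a multiple of the Poisson kernel, whose moments against \<open>1\<close>, \<open>cos\<close> and
  \<open>cos\<^sup>2\<close> are rational in \<open>x\<close>. Since the potential has rank two, \<open>z\<close> is an eigenvalue iff a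
  \<open>2 \<times> 2\<close> determinant vanishes, and with \<open>x = \<mp> 1 / u\<close>, \<open>u > 1\<close>, this becomes a monic cubic
  equation in \<open>u\<close>. At \<open>u = 1\<close> the cubic equals \<open>2 (\<mu> lam \<mp> \<mu> \<mp> lam)\<close>, so the regions encode
  its sign there, and the roots \<open>u > 1\<close> are counted by Descartes' rule for the expansion around
  \<open>u = 1\<close>. At the roots belonging to the two rank-one problems the cubic is negative, which gives
  the interlacing with \<open>zeta_mu\<close> and \<open>zeta_lambda\<close>.\<close>

section \<open>Resolvent moments and the characteristic determinant\<close>

lemma haar_torus_eq_density:
  "haar_torus = density (restrict_space lborel {-pi<..pi}) (\<lambda>_. ennreal (1 / (2 * pi)))"
  unfolding haar_torus_def by (rule measure_eqI) (auto simp: emeasure_density_const)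

lemma borel_measurable_haar_torus_continuous:
  "continuous_on UNIV f \<Longrightarrow> f \<in> borel_measurable haar_torus"
  using measurable_restrict_space1[of f lborel borel "{-pi<..pi}"] borel_measurable_continuous_onI[of f]
  by (simp add: haar_torus_def)

lemma space_haar_torus: "space haar_torus = {-pi<..pi}"
  by (simp add: haar_torus_def space_scale_measure space_restrict_space)

lemma integrable_haar_torus_continuous:
  fixes f :: "real \<Rightarrow> 'b::{banach, second_countable_topology}"
  assumes "continuous_on UNIV f"
  shows "integrable haar_torus f"
proof -
  have "compact (f ` {-pi..pi})"
    using assms by (intro compact_continuous_image) (auto intro: continuous_on_subset)
  then have "bounded (f ` {-pi..pi})" by (rule compact_imp_bounded)
  then obtain B where "\<forall>y\<in>f ` {-pi..pi}. norm y \<le> B" unfolding bounded_iff ..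
  then have "norm (f p) \<le> B" if "p \<in> {-pi..pi}" for p using that by blast
  then show ?thesis
    by (intro finite_measure.integrable_const_bound[OF finite_measure_haar_torus, where B = B] AE_I2
        borel_measurable_haar_torus_continuous assms) (auto simp: space_haar_torus)
qed

text \<open>Torus integrals are computed from a primitive on the whole line. \<open>F\<close> may
  fail to be periodic, and its increment over one period is the integral.\<close>

lemma has_bochner_integral_haar_torus_FTC:
  fixes f F :: "real \<Rightarrow> real"
  assumes F: "\<And>p. (F has_real_derivative f p) (at p)" and f: "\<And>p. isCont f p"
  shows "has_bochner_integral haar_torus f ((F pi - F (- pi)) / (2 * pi))"
proof -
  have [measurable]: "f \<in> borel_measurable borel"
    using f by (intro borel_measurable_continuous_onI continuous_at_imp_continuous_on) auto
  have i: "has_bochner_integral lborel (\<lambda>p. f p * indicator {-pi..pi} p) (F pi - F (- pi))"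
    by (intro has_bochner_integral_FTC_Icc_real F f) simp
  \<comment> \<open>The fundamental theorem is stated on the closed interval while the domain is
    half-open; the two differ by the null set of the left endpoint.\<close>
  have "AE p in lborel. p \<noteq> - pi" by (rule AE_lborel_singleton)
  then have ae: "AE p in lborel. f p * indicator {-pi..pi} p = indicator {-pi<..pi} p *\<^sub>R f p"
    by eventually_elim (auto simp: indicator_def)
  have "has_bochner_integral lborel (\<lambda>p. indicator {-pi<..pi} p *\<^sub>R f p) (F pi - F (- pi))"
    by (rule iffD1[OF has_bochner_integral_cong_AE[OF _ _ ae] i]) measurable
  then have "has_bochner_integral (restrict_space lborel {-pi<..pi}) f (F pi - F (- pi))"
    by (subst has_bochner_integral_restrict_space) auto
  then have "has_bochner_integral (restrict_space lborel {-pi<..pi}) (\<lambda>p. (1 / (2 * pi)) *\<^sub>R f p)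
      ((1 / (2 * pi)) *\<^sub>R (F pi - F (- pi)))"
    by (rule has_bochner_integral_scaleR_right)
  moreover have "f \<in> borel_measurable (restrict_space lborel {-pi<..pi})"
    by (intro measurable_restrict_space1) simp
  ultimately have "has_bochner_integral haar_torus f ((1 / (2 * pi)) *\<^sub>R (F pi - F (- pi)))"
    unfolding haar_torus_eq_density 
    by (intro has_bochner_integral_density[where g = "\<lambda>_. 1 / (2 * pi)"] AE_I2) simp_all
  then show ?thesis by simp
qed

text \<open>The multiplier \<open>1 / (w - cos p)\<close> for \<open>w = (x + 1 / x) / 2\<close>.\<close>

definition res_kernel :: "real \<Rightarrow> real \<Rightarrow> real" where
  "res_kernel x p = 2 * x / (1 - 2 * x * cos p + x\<^sup>2)"

section \<open>The Poisson kernel and its trigonometric moments\<close>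

lemma poisson_denominator_pos:
  fixes x p :: real
  assumes "\<bar>x\<bar> < 1"
  shows "0 < 1 - 2 * x * cos p + x\<^sup>2"
proof -
  have "\<bar>x * cos p\<bar> \<le> \<bar>x\<bar> * 1" unfolding abs_mult by (intro mult_left_mono) auto
  moreover have "0 < (1 - \<bar>x\<bar>)\<^sup>2" using assms by simp
  ultimately show ?thesis by (simp add: power2_diff)
qed

lemma continuous_on_res_kernel [continuous_intros]:
  "\<bar>x\<bar> < 1 \<Longrightarrow> continuous_on A (res_kernel x)"
  unfolding res_kernel_def
  by (intro continuous_intros ballI less_imp_neq[THEN not_sym] poisson_denominator_pos)

lemma res_kernel_inverse:
  assumes "\<bar>x\<bar> < 1" "x \<noteq> 0"
  shows "((x + 1 / x) / 2 - cos p) * res_kernel x p = 1"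
proof -
  have "1 - 2 * x * cos p + x\<^sup>2 \<noteq> 0" using poisson_denominator_pos[OF assms(1), of p] by simp
  moreover have "(x + 1 / x) / 2 - cos p = (1 - 2 * x * cos p + x\<^sup>2) / (2 * x)"
    using assms by (simp add: field_simps power2_eq_square)
  ultimately show ?thesis using assms by (simp add: res_kernel_def)
qed

text \<open>Up to the factor \<open>2 * x / (1 - x\<^sup>2)\<close> this is the Poisson kernel,
  whose mean over the torus is 1.\<close>

lemma res_kernel_moment_0:
  assumes "\<bar>x\<bar> < 1"
  shows "has_bochner_integral haar_torus (res_kernel x) (2 * x / (1 - x\<^sup>2))"
proof -
  have x2: "x\<^sup>2 < 1" using assms by (simp add: abs_square_less_1)
  \<comment> \<open>\<open>F\<close> is smooth on the whole line, as \<open>arctan (x * sin p / (1 - x * cos p))\<close> is the argument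
    of \<open>1 / (1 - x * cis p)\<close>.\<close>
  define F where "F p = 2 * x / (1 - x\<^sup>2) * (p + 2 * arctan (x * sin p / (1 - x * cos p)))" for p
  have pos: "0 < 1 - x * cos p" for p
  proof -
    have "\<bar>x * cos p\<bar> \<le> \<bar>x\<bar> * 1" unfolding abs_mult by (intro mult_left_mono) auto
    then show ?thesis using assms by linarith
  qed
  have "(F has_real_derivative res_kernel x p) (at p)" for p
  proof -
    \<comment> \<open>\<open>c\<close> and \<open>- s\<close> are the real and imaginary parts of
      \<open>1 - x * cis p\<close>, and \<open>d\<close> is its squared modulus.\<close>
    define c s where "c = 1 - x * cos p" and "s = x * sin p"
    define d where "d = 1 - 2 * x * cos p + x\<^sup>2"
    have cs: "x * cos p * c - s * s = x * cos p - x\<^sup>2" "c\<^sup>2 + s\<^sup>2 = d"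
      using sin_cos_squared_add[of p] unfolding c_def s_def d_def by algebra+
    have c: "0 < c" and d: "0 < d"
      using pos[of p] poisson_denominator_pos[OF assms, of p] by (simp_all add: c_def d_def)
    have "((\<lambda>p. x * sin p / (1 - x * cos p)) has_real_derivative (x * cos p * c - s * s) / (c * c)) (at p)"
      using c by (auto intro!: derivative_eq_intros simp: c_def s_def)
    from DERIV_chain2[OF DERIV_arctan this]
    have "((\<lambda>p. arctan (x * sin p / (1 - x * cos p))) has_real_derivative
        inverse (1 + (s / c)\<^sup>2) * ((x * cos p - x\<^sup>2) / (c * c))) (at p)"
      unfolding cs(1) by (simp add: c_def s_def)
    then have "(F has_real_derivative
        2 * x / (1 - x\<^sup>2) * (1 + 2 * (inverse (1 + (s / c)\<^sup>2) * ((x * cos p - x\<^sup>2) / (c * c))))) (at p)"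
      unfolding F_def by (intro DERIV_cmult DERIV_add DERIV_ident)
    moreover have "1 + (s / c)\<^sup>2 = d / (c * c)"
      using c cs(2) by (simp add: field_simps power2_eq_square)
    then have "inverse (1 + (s / c)\<^sup>2) * ((x * cos p - x\<^sup>2) / (c * c)) = (x * cos p - x\<^sup>2) / d"
      using c d by simp
    moreover have "1 + 2 * ((x * cos p - x\<^sup>2) / d) = (1 - x\<^sup>2) / d"
      using d by (simp add: field_simps) (simp add: d_def)
    ultimately have "(F has_real_derivative 2 * x / (1 - x\<^sup>2) * ((1 - x\<^sup>2) / d)) (at p)"
      by (simp only:)
    then show ?thesis using x2 by (simp add: res_kernel_def d_def)
  qed
  moreover have "isCont (res_kernel x) p" for p
    using continuous_on_res_kernel[OF assms, of UNIV] by (simp add: continuous_on_eq_continuous_at)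
  ultimately have "has_bochner_integral haar_torus (res_kernel x) ((F pi - F (- pi)) / (2 * pi))"
    by (rule has_bochner_integral_haar_torus_FTC)
  moreover have "(F pi - F (- pi)) / (2 * pi) = 2 * x / (1 - x\<^sup>2)"
  proof -
    \<comment> \<open>The arctan terms vanish at both endpoints because the sine does, so only the
      linear part of \<open>F\<close> contributes.\<close>
    have "F pi - F (- pi) = 2 * x / (1 - x\<^sup>2) * (2 * pi)"
      unfolding F_def right_diff_distrib[symmetric] by simp
    moreover have "2 * pi \<noteq> 0" by simp
    ultimately show ?thesis by (metis nonzero_mult_div_cancel_right)
  qed
  ultimately show ?thesis by simp
qed

lemma has_bochner_integral_haar_torus_cos: "has_bochner_integral haar_torus cos 0"
  using has_bochner_integral_haar_torus_FTC[of sin cos] by (auto intro!: derivative_eq_intros)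

lemma has_bochner_integral_haar_torus_const: "has_bochner_integral haar_torus (\<lambda>_. c) (c::real)"
  using has_bochner_integral_haar_torus_FTC[of "\<lambda>p. c * p" "\<lambda>_. c"] by (auto intro!: derivative_eq_intros)

text \<open>A factor \<open>cos p\<close> is traded for the constant \<open>(x + 1 / x) / 2\<close>,
  so the moments against \<open>cos p\<close> and its square follow from the zeroth one.\<close>

lemma res_kernel_mult_cos:
  assumes "\<bar>x\<bar> < 1" "x \<noteq> 0"
  shows "cos p * res_kernel x p = (x + 1 / x) / 2 * res_kernel x p - 1"
  using res_kernel_inverse[OF assms, of p] by (simp add: algebra_simps)

lemma res_kernel_moment_1:
  assumes "\<bar>x\<bar> < 1" "x \<noteq> 0"
  shows "has_bochner_integral haar_torus (\<lambda>p. cos p * res_kernel x p) (2 * x\<^sup>2 / (1 - x\<^sup>2))"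
proof -
  have x2: "x\<^sup>2 < 1" using assms by (simp add: abs_square_less_1)
  have "has_bochner_integral haar_torus (\<lambda>p. (x + 1 / x) / 2 * res_kernel x p - 1)
      ((x + 1 / x) / 2 * (2 * x / (1 - x\<^sup>2)) - 1)"
    by (intro has_bochner_integral_diff has_bochner_integral_mult_right
        res_kernel_moment_0 has_bochner_integral_haar_torus_const assms)
  moreover have "(x + 1 / x) / 2 * (2 * x / (1 - x\<^sup>2)) - 1 = 2 * x\<^sup>2 / (1 - x\<^sup>2)"
    using assms x2 by (simp add: field_simps power2_eq_square)
  ultimately show ?thesis by (simp only: res_kernel_mult_cos[OF assms])
qed

lemma res_kernel_moment_2:
  assumes "\<bar>x\<bar> < 1" "x \<noteq> 0"
  shows "has_bochner_integral haar_torus (\<lambda>p. cos p * (cos p * res_kernel x p)) (x * (1 + x\<^sup>2) / (1 - x\<^sup>2))"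
proof -
  have x2: "x\<^sup>2 < 1" using assms by (simp add: abs_square_less_1)
  have "has_bochner_integral haar_torus (\<lambda>p. (x + 1 / x) / 2 * (cos p * res_kernel x p) - cos p)
      ((x + 1 / x) / 2 * (2 * x\<^sup>2 / (1 - x\<^sup>2)) - 0)"
    by (intro has_bochner_integral_diff has_bochner_integral_mult_right
        res_kernel_moment_1 has_bochner_integral_haar_torus_cos assms)
  moreover have "(x + 1 / x) / 2 * (2 * x\<^sup>2 / (1 - x\<^sup>2)) - 0 = x * (1 + x\<^sup>2) / (1 - x\<^sup>2)"
    using assms x2 by (simp add: field_simps power2_eq_square)
  moreover have "(x + 1 / x) / 2 * (cos p * res_kernel x p) - cos p = cos p * (cos p * res_kernel x p)" for p
  proof -
    have "w * (cos p * res_kernel x p) - cos p = cos p * (w * res_kernel x p - 1)" for w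
      by (simp add: algebra_simps)
    then show ?thesis by (simp only: res_kernel_mult_cos[OF assms, symmetric])
  qed
  ultimately show ?thesis by (simp only:)
qed

text \<open>Self-adjointness tested on an eigenfunction gives \<open>z * N = cnj z * N\<close>,
  where \<open>N\<close> is its nonzero squared norm. Eigenvalues are complex by definition, so this
  is what confines them to the real line.\<close>

lemma eigenvalue_real:
  assumes "is_eigenvalue (H_op \<mu> lam) z"
  shows "z \<in> \<real>"
proof -
  obtain f where f: "f \<in> L2_even" and nz: "\<not> (AE p in haar_torus. f p = 0)"
    and eig: "AE p in haar_torus. H_op \<mu> lam f p = z * f p"
    using assms by (auto simp: is_eigenvalue_def)
  define N where "N = (LINT p|haar_torus. (cmod (f p))\<^sup>2)"
  have [measurable]: "f \<in> borel_measurable haar_torus" "H_op \<mu> lam f \<in> borel_measurable haar_torus"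
    using f H_op_L2_even[OF f, of \<mu> lam] by (simp_all add: L2_even_def)
  have [measurable]: "(\<lambda>p. cnj (f p)) \<in> borel_measurable haar_torus"
      "(\<lambda>p. cnj (H_op \<mu> lam f p)) \<in> borel_measurable haar_torus"
    by (auto intro!: measurable_compose[OF _ borel_measurable_continuous_onI[of cnj]] continuous_intros)
  have int: "integrable haar_torus (\<lambda>p. (cmod (f p))\<^sup>2)" using f by (simp add: L2_even_def)
  have "N \<noteq> 0"
    using nz integral_nonneg_eq_0_iff_AE[OF int] by (auto simp: N_def)
  have "L2_inner (H_op \<mu> lam f) f = (LINT p|haar_torus. z * complex_of_real ((cmod (f p))\<^sup>2))"
    unfolding L2_inner_def
    by (rule integral_cong_AE) (use eig in \<open>auto simp: complex_norm_square mult.assoc simp del: of_real_power\<close>)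
  then have 1: "L2_inner (H_op \<mu> lam f) f = z * complex_of_real N"
    by (simp only: integral_mult_right_zero integral_complex_of_real N_def)
  have "L2_inner f (H_op \<mu> lam f) = (LINT p|haar_torus. cnj z * complex_of_real ((cmod (f p))\<^sup>2))"
    unfolding L2_inner_def
    by (rule integral_cong_AE) (use eig in \<open>auto simp: complex_norm_square mult_ac simp del: of_real_power\<close>)
  then have 2: "L2_inner f (H_op \<mu> lam f) = cnj z * complex_of_real N"
    by (simp only: integral_mult_right_zero integral_complex_of_real N_def)
  have "z = cnj z" using 1 2 H_op_selfadjoint[OF f f, of \<mu> lam] \<open>N \<noteq> 0\<close> by simp
  then show ?thesis using Reals_cnj_iff by metis
qed

section \<open>Reduction of the eigenvalue equation to a 2 by 2 linear system\<close>

lemma kernel_2x2: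
  fixes a b c d :: real
  assumes "a * d - b * c = 0"
  obtains s t where "s \<noteq> 0 \<or> t \<noteq> 0" "a * s + b * t = 0" "c * s + d * t = 0"
proof (cases "a = 0 \<and> b = 0")
  case True
  then show ?thesis using that[of d "- c"] that[of 1 0] by (cases "c = 0 \<and> d = 0") auto
next
  case False
  \<comment> \<open>\<open>(b, - a)\<close> is perpendicular to the nonzero first row, and the
    vanishing determinant makes it perpendicular to the second.\<close>
  then show ?thesis using that[of b "- a"] assms by (auto simp: algebra_simps)
qed

lemma resolvent_eq:
  fixes c f r z :: complex
  shows "c * f + r = z * f \<longleftrightarrow> f * (c - z) = - r"
proof -
  have "c * f + r - z * f = f * (c - z) + r" by (simp add: algebra_simps)
  then show ?thesis by (metis add_eq_0_iff2 eq_iff_diff_eq_0)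
qed

text \<open>The three fractions are the moments of the resolvent multiplier against \<open>1\<close>, \<open>cos\<^sup>2\<close> and \<open>cos\<close>.\<close>

definition fredholm_det :: "real \<Rightarrow> real \<Rightarrow> real \<Rightarrow> real" where
  "fredholm_det \<mu> lam x =
     (1 + \<mu> * (2 * x / (1 - x\<^sup>2))) * (1 + lam * (x * (1 + x\<^sup>2) / (1 - x\<^sup>2)))
     - (lam * (2 * x\<^sup>2 / (1 - x\<^sup>2))) * (\<mu> * (2 * x\<^sup>2 / (1 - x\<^sup>2)))"

text \<open>The moments against 1 and the squared cosine are odd in \<open>x\<close>, the one
  against the cosine is even. This symmetry transfers every statement about eigenvalues above 2 to
  eigenvalues below 0.\<close>

lemma fredholm_det_minus: "fredholm_det \<mu> lam (- x) = fredholm_det (- \<mu>) (- lam) x"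
  by (simp add: fredholm_det_def)

text \<open>Dividing by \<open>1 - cos p - z\<close> expresses an eigenfunction through its own two
  moments \<open>a\<close> and \<open>b\<close>. Taking moments again yields a homogeneous linear
  system for \<open>(a, b)\<close>, whose determinant is \<open>fredholm_det\<close>.\<close>

lemma is_eigenvalue_iff_fredholm_det:
  assumes x: "\<bar>x\<bar> < 1" "x \<noteq> 0"
  shows "is_eigenvalue (H_op \<mu> lam) (complex_of_real (1 - (x + 1 / x) / 2)) \<longleftrightarrow> fredholm_det \<mu> lam x = 0"
proof
  define m0 m1 m2 where "m0 = 2 * x / (1 - x\<^sup>2)" and "m1 = 2 * x\<^sup>2 / (1 - x\<^sup>2)"
    and "m2 = x * (1 + x\<^sup>2) / (1 - x\<^sup>2)"
  have det_eq: "fredholm_det \<mu> lam x = (1 + \<mu> * m0) * (1 + lam * m2) - (lam * m1) * (\<mu> * m1)"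
    by (simp only: fredholm_det_def m0_def m1_def m2_def)
  define K where "K = res_kernel x"
  define z where "z = complex_of_real (1 - (x + 1 / x) / 2)"
  have K: "complex_of_real (1 - cos p) - z \<noteq> 0" "complex_of_real (K p) = 1 / (complex_of_real (1 - cos p) - z)" for p
  proof -
    have "complex_of_real (((x + 1 / x) / 2 - cos p) * K p) = 1"
      using res_kernel_inverse[OF x, of p] by (simp only: K_def of_real_1)
    then have "(complex_of_real (1 - cos p) - z) * complex_of_real (K p) = 1"
      unfolding z_def of_real_mult[symmetric] of_real_diff[symmetric] by simp
    then show "complex_of_real (1 - cos p) - z \<noteq> 0" "complex_of_real (K p) = 1 / (complex_of_real (1 - cos p) - z)"
      using inverse_unique[of "complex_of_real (1 - cos p) - z" "complex_of_real (K p)"]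
      by (force, simp only: inverse_eq_divide)
  qed
  have m: "has_bochner_integral haar_torus (\<lambda>p. complex_of_real (K p)) (complex_of_real m0)"
    "has_bochner_integral haar_torus (\<lambda>p. complex_of_real (cos p * K p)) (complex_of_real m1)"
    "has_bochner_integral haar_torus (\<lambda>p. complex_of_real (cos p * (cos p * K p))) (complex_of_real m2)"
    unfolding K_def m0_def m1_def m2_def
    by (intro has_bochner_integral_of_real res_kernel_moment_0 res_kernel_moment_1 res_kernel_moment_2 x)+
  have cK [continuous_intros]: "continuous_on A K" for A
    unfolding K_def by (rule continuous_on_res_kernel[OF x(1)])
  \<comment> \<open>The only candidate for an eigenfunction whose moments against 1 and the cosine
    are \<open>a\<close> and \<open>b\<close>.\<close>
  define g where "g a b p = - (\<mu> * a) * complex_of_real (K p) + - (lam * b) * complex_of_real (cos p * K p)"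
    for a b :: complex and p
  have g0: "has_bochner_integral haar_torus (g a b) (- (\<mu> * a) * m0 + - (lam * b) * m1)" for a b :: complex
    unfolding g_def by (intro has_bochner_integral_add has_bochner_integral_mult_right m)
  have "has_bochner_integral haar_torus (\<lambda>p. - (\<mu> * a) * complex_of_real (cos p * K p)
      + - (lam * b) * complex_of_real (cos p * (cos p * K p))) (- (\<mu> * a) * m1 + - (lam * b) * m2)" for a b :: complex
    by (intro has_bochner_integral_add has_bochner_integral_mult_right m)
  then have g1: "has_bochner_integral haar_torus (\<lambda>p. complex_of_real (cos p) * g a b p)
      (- (\<mu> * a) * m1 + - (lam * b) * m2)" for a b :: complex
    by (simp add: g_def algebra_simps)
  have cg: "continuous_on UNIV (g a b)" for a b
    unfolding g_def by (intro continuous_intros)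
  have gm: "g a b \<in> borel_measurable haar_torus" for a b
    by (rule borel_measurable_haar_torus_continuous[OF cg])
  have gK: "g a b p * (complex_of_real (1 - cos p) - z) = - (\<mu> * a + complex_of_real (lam * cos p) * b)" for a b :: complex and p
  proof -
    have "g a b p * (complex_of_real (1 - cos p) - z) =
        - (\<mu> * a + complex_of_real (lam * cos p) * b) * (complex_of_real (K p) * (complex_of_real (1 - cos p) - z))"
      by (simp add: g_def algebra_simps)
    then show ?thesis using K(1)[of p] unfolding K(2) by simp
  qed
  show "fredholm_det \<mu> lam x = 0"
    if ev: "is_eigenvalue (H_op \<mu> lam) (complex_of_real (1 - (x + 1 / x) / 2))"
  proof -
    obtain f where f: "f \<in> L2_even" and nz: "\<not> (AE p in haar_torus. f p = 0)"
      and eig: "AE p in haar_torus. H_op \<mu> lam f p = z * f p"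
      using ev by (auto simp: is_eigenvalue_def z_def)
    define a where "a = (LINT t|haar_torus. f t)"
    define b where "b = (LINT t|haar_torus. complex_of_real (cos t) * f t)"
    have [measurable]: "f \<in> borel_measurable haar_torus" using f by (simp add: L2_even_def)
    have fg: "AE p in haar_torus. f p = g a b p"
      using eig
    proof eventually_elim
      case (elim p)
      have "H_op \<mu> lam f p = complex_of_real (1 - cos p) * f p + (\<mu> * a + complex_of_real (lam * cos p) * b)"
        by (simp add: H_op_def H_free_def dispersion_def V_pot_eq[OF f] a_def b_def)
      then have "f p * (complex_of_real (1 - cos p) - z) = - (\<mu> * a + complex_of_real (lam * cos p) * b)"
        using elim resolvent_eq by metis
      then show ?case using gK[of a b p] K(1)[of p] by (metis mult_right_cancel)
    qed
    note [measurable] = gm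
    have "(LINT t|haar_torus. f t) = (LINT t|haar_torus. g a b t)"
      using fg by (intro integral_cong_AE) auto
    then have a: "a = - (\<mu> * a) * m0 + - (lam * b) * m1"
      using has_bochner_integral_integral_eq[OF g0[of a b]] by (simp only: a_def[symmetric])
    have "(LINT t|haar_torus. complex_of_real (cos t) * f t) = (LINT t|haar_torus. complex_of_real (cos t) * g a b t)"
      using fg by (intro integral_cong_AE) auto
    then have b: "b = - (\<mu> * a) * m1 + - (lam * b) * m2"
      using has_bochner_integral_integral_eq[OF g1[of a b]] by (simp only: b_def[symmetric])
    \<comment> \<open>If both moments vanished, \<open>g a b\<close> and hence \<open>f\<close>
      would vanish almost everywhere.\<close>
    have "a \<noteq> 0 \<or> b \<noteq> 0" using fg nz by (auto simp: g_def)
    define D where "D = (1 + \<mu> * m0) * (1 + lam * m2) - (lam * m1) * (\<mu> * m1)"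
    \<comment> \<open>Cramer's rule: the adjugate matrix is applied to the two moment equations, so
      \<open>D\<close> annihilates both \<open>a\<close> and \<open>b\<close>.\<close>
    have "complex_of_real D * a = (1 + lam * m2) * (a - (- (\<mu> * a) * m0 + - (lam * b) * m1))
      - lam * m1 * (b - (- (\<mu> * a) * m1 + - (lam * b) * m2))"
      by (simp add: D_def algebra_simps)
    then have "complex_of_real D * a = 0" unfolding a[symmetric] b[symmetric] by simp
    moreover have "complex_of_real D * b = (1 + \<mu> * m0) * (b - (- (\<mu> * a) * m1 + - (lam * b) * m2))
      - \<mu> * m1 * (a - (- (\<mu> * a) * m0 + - (lam * b) * m1))"
      by (simp add: D_def algebra_simps)
    then have "complex_of_real D * b = 0" unfolding a[symmetric] b[symmetric] by simp
    ultimately have "D = 0" using \<open>a \<noteq> 0 \<or> b \<noteq> 0\<close> by auto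
    then show ?thesis by (simp add: D_def det_eq)
  qed
  show "is_eigenvalue (H_op \<mu> lam) (complex_of_real (1 - (x + 1 / x) / 2))"
    if det: "fredholm_det \<mu> lam x = 0"
  proof -
    \<comment> \<open>A null vector of the system supplies the moments. The two equations then say
      that \<open>g a b\<close> really has moments \<open>a\<close> and \<open>b\<close>, which
      makes it an eigenfunction.\<close>
    obtain s t where st: "s \<noteq> 0 \<or> t \<noteq> 0" "(1 + \<mu> * m0) * s + lam * m1 * t = 0"
        "\<mu> * m1 * s + (1 + lam * m2) * t = 0"
      using kernel_2x2[OF det[unfolded det_eq]] by blast
    define a b where "a = complex_of_real s" and "b = complex_of_real t"
    define f where "f = g a b"
    have "- (\<mu> * s) * m0 + - (lam * t) * m1 = s" "- (\<mu> * s) * m1 + - (lam * t) * m2 = t"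
      using st(2,3) by (simp_all add: algebra_simps)
    then have "- (\<mu> * a) * m0 + - (lam * b) * m1 = a" "- (\<mu> * a) * m1 + - (lam * b) * m2 = b"
      unfolding a_def b_def of_real_mult[symmetric] of_real_minus[symmetric] of_real_add[symmetric] by simp_all
    then have fa: "(LINT p|haar_torus. f p) = a" and fb: "(LINT p|haar_torus. complex_of_real (cos p) * f p) = b"
      using has_bochner_integral_integral_eq[OF g0[of a b]] has_bochner_integral_integral_eq[OF g1[of a b]]
      by (simp_all add: f_def)
    have [measurable]: "f \<in> borel_measurable haar_torus" unfolding f_def by (rule gm)
    have "integrable haar_torus (\<lambda>p. (cmod (f p))\<^sup>2)"
      unfolding f_def by (intro integrable_haar_torus_continuous continuous_intros cg)
    moreover have "f p = f (- p)" for p by (simp add: f_def g_def K_def res_kernel_def)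
    ultimately have f: "f \<in> L2_even" by (simp add: L2_even_def)
    have "H_op \<mu> lam f p = z * f p" for p
    proof -
      have "H_op \<mu> lam f p = complex_of_real (1 - cos p) * f p + (\<mu> * a + complex_of_real (lam * cos p) * b)"
        by (simp add: H_op_def H_free_def dispersion_def V_pot_eq[OF f] fa fb)
      then show ?thesis using gK[of a b p] by (simp only: resolvent_eq f_def)
    qed
    moreover have "\<not> (AE p in haar_torus. f p = 0)"
    proof
      assume 0: "AE p in haar_torus. f p = 0"
      have "a = (LINT p|haar_torus. 0)" unfolding fa[symmetric]
        using 0 by (intro integral_cong_AE) auto
      moreover have "b = (LINT p|haar_torus. 0)" unfolding fb[symmetric]
        using 0 by (intro integral_cong_AE) auto
      ultimately show False using st(1) by (simp add: a_def b_def)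
    qed
    ultimately show ?thesis using f by (auto simp: is_eigenvalue_def z_def)
  qed
qed

section \<open>Roots of the characteristic cubic\<close>

text \<open>The numerator of \<open>fredholm_det\<close> at \<open>x = - 1 / u\<close> after a
  factor \<open>u\<^sup>2 - 1\<close> has cancelled.\<close>

definition char_cubic :: "real \<Rightarrow> real \<Rightarrow> real \<Rightarrow> real" where
  "char_cubic \<mu> lam u = u * (u - 2 * \<mu>) * (u - lam) - (u + lam)"

text \<open>The excluded value \<open>u = 1\<close> corresponds to an edge of the essential
  spectrum.\<close>

definition char_roots :: "real \<Rightarrow> real \<Rightarrow> real set" where
  "char_roots \<mu> lam = {u. 1 < u \<and> char_cubic \<mu> lam u = 0}"

text \<open>Roots \<open>u > 1\<close> become positive roots \<open>v\<close>, to which sign rules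
  for the coefficients apply; the constant term carries the sign that defines the regions.\<close>

lemma char_cubic_shift:
  "char_cubic \<mu> lam (1 + v) =
     v ^ 3 + (3 - 2 * \<mu> - lam) * v\<^sup>2 + 2 * ((\<mu> - 1) * (lam - 2) - 1) * v + 2 * (\<mu> * lam - \<mu> - lam)"
  by (simp add: char_cubic_def power2_eq_square power3_eq_cube algebra_simps)

lemma continuous_on_char_cubic [continuous_intros]: "continuous_on A (char_cubic \<mu> lam)"
  unfolding char_cubic_def by (intro continuous_intros)

lemma cubic_eventually_pos:
  fixes b c d K :: real
  obtains v where "K < v" "0 < v ^ 3 + b * v\<^sup>2 + c * v + d"
proof -
  \<comment> \<open>With this choice \<open>v ^ 3\<close> splits into \<open>v\<^sup>2\<close> plus
    one term dominating each lower-order term, and \<open>v\<close> exceeds the prescribed bound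
    \<open>K\<close>.\<close>
  define v where "v = 1 + \<bar>K\<bar> + \<bar>b\<bar> + \<bar>c\<bar> + \<bar>d\<bar>"
  have v: "1 \<le> v" "K < v" by (auto simp: v_def)
  then have v2: "v \<le> v\<^sup>2" "1 \<le> v\<^sup>2" by (auto simp: power2_eq_square intro: mult_mono[of 1 v 1 v, simplified])
  have "- (b * v\<^sup>2) \<le> \<bar>b\<bar> * v\<^sup>2" "- (c * v) \<le> \<bar>c\<bar> * v\<^sup>2" "- d \<le> \<bar>d\<bar> * v\<^sup>2"
  proof -
    show "- (b * v\<^sup>2) \<le> \<bar>b\<bar> * v\<^sup>2"
      by (metis abs_ge_minus_self mult_minus_left mult_right_mono zero_le_power2)
    have "- (c * v) \<le> \<bar>c\<bar> * v"
      using v by (metis abs_ge_minus_self mult_minus_left mult_right_mono order_trans zero_le_one)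
    also have "\<dots> \<le> \<bar>c\<bar> * v\<^sup>2" using v2 by (intro mult_left_mono) auto
    finally show "- (c * v) \<le> \<bar>c\<bar> * v\<^sup>2" .
    have "- d \<le> \<bar>d\<bar> * 1" by simp
    also have "\<dots> \<le> \<bar>d\<bar> * v\<^sup>2" using v2 by (intro mult_left_mono) auto
    finally show "- d \<le> \<bar>d\<bar> * v\<^sup>2" .
  qed
  moreover have "v ^ 3 = v\<^sup>2 + \<bar>K\<bar> * v\<^sup>2 + \<bar>b\<bar> * v\<^sup>2 + \<bar>c\<bar> * v\<^sup>2 + \<bar>d\<bar> * v\<^sup>2"
    by (simp add: v_def power3_eq_cube power2_eq_square algebra_simps)
  moreover have "0 \<le> \<bar>K\<bar> * v\<^sup>2" by simp
  ultimately show ?thesis using that[of v] v v2 by linarith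
qed

lemma char_cubic_eventually_pos:
  obtains u where "K < u" "0 < char_cubic \<mu> lam u"
proof -
  obtain v where "K - 1 < v" and
    "0 < v ^ 3 + (3 - 2 * \<mu> - lam) * v\<^sup>2 + 2 * ((\<mu> - 1) * (lam - 2) - 1) * v + 2 * (\<mu> * lam - \<mu> - lam)"
    by (rule cubic_eventually_pos)
  then show ?thesis using that[of "1 + v"] by (simp add: char_cubic_shift)
qed

section \<open>Existence and number of roots: intermediate values, Vieta and Descartes\<close>

lemma char_cubic_root_between:
  assumes "a < b" "char_cubic \<mu> lam a * char_cubic \<mu> lam b < 0"
  obtains u where "a < u" "u < b" "char_cubic \<mu> lam u = 0"
proof -
  have c: "continuous_on {a..b} (char_cubic \<mu> lam)" by (rule continuous_on_char_cubic)
  have "\<exists>u. a \<le> u \<and> u \<le> b \<and> char_cubic \<mu> lam u = 0"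
  proof (cases "char_cubic \<mu> lam a < 0")
    case True
    then have "0 < char_cubic \<mu> lam b" using assms(2) by (auto simp: mult_less_0_iff)
    then show ?thesis using IVT'[of "char_cubic \<mu> lam" a 0 b] True assms c by auto
  next
    case False
    then have "0 \<le> char_cubic \<mu> lam a" "char_cubic \<mu> lam b \<le> 0" using assms(2) by (auto simp: mult_less_0_iff)
    then show ?thesis using IVT2'[of "char_cubic \<mu> lam" b 0 a] assms c by auto
  qed
  then obtain u where u: "a \<le> u" "u \<le> b" "char_cubic \<mu> lam u = 0" by blast
  then have "u \<noteq> a" "u \<noteq> b" using assms(2) by auto
  then show ?thesis using that[of u] u by auto
qed

text \<open>Eliminating \<open>q\<close> and \<open>r\<close> from the three equations leaves the
  Vandermonde product times \<open>x + y + z + p\<close>. Two known roots thus determine any further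
  root distinct from both.\<close>

lemma monic_cubic_root_sum:
  fixes p q r x y z :: real
  assumes "x \<noteq> y" "x \<noteq> z" "y \<noteq> z"
    and "x ^ 3 + p * x\<^sup>2 + q * x + r = 0" "y ^ 3 + p * y\<^sup>2 + q * y + r = 0" "z ^ 3 + p * z\<^sup>2 + q * z + r = 0"
  shows "x + y + z = - p"
proof -
  have "(x - y) * (x - z) * (y - z) * (x + y + z + p) =
      (x ^ 3 + p * x\<^sup>2 + q * x + r) * (y - z) - (y ^ 3 + p * y\<^sup>2 + q * y + r) * (x - z)
      + (z ^ 3 + p * z\<^sup>2 + q * z + r) * (x - y)"
    by (simp add: power2_eq_square power3_eq_cube algebra_simps)
  then have "(x - y) * (x - z) * (y - z) * (x + y + z + p) = 0" using assms by simp
  then show ?thesis using assms by auto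
qed

lemma char_cubic_root_sum:
  assumes "x \<noteq> y" "x \<noteq> z" "y \<noteq> z"
    and "char_cubic \<mu> lam x = 0" "char_cubic \<mu> lam y = 0" "char_cubic \<mu> lam z = 0"
  shows "x + y + z = 2 * \<mu> + lam"
proof -
  have "char_cubic \<mu> lam u = u ^ 3 + (- (2 * \<mu> + lam)) * u\<^sup>2 + (2 * \<mu> * lam - 1) * u + (- lam)" for u
    by (simp add: char_cubic_def power2_eq_square power3_eq_cube algebra_simps)
  then show ?thesis using monic_cubic_root_sum[of x y z "- (2 * \<mu> + lam)" "2 * \<mu> * lam - 1" "- lam"] assms by auto
qed

text \<open>Descartes' rule when the coefficients \<open>1, b, c, d\<close> have a single sign
  change. Eliminating \<open>c\<close> (if \<open>0 \<le> b\<close>) or \<open>b\<close> (if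
  \<open>c \<le> 0\<close>) from the equations of two distinct roots leaves an expression of strict
  sign that would have to vanish.\<close>

lemma cubic_unique_pos_root:
  fixes b c d :: real
  assumes bc: "0 \<le> b \<or> c \<le> 0" and dc: "d < 0 \<or> d = 0 \<and> c < 0"
    and "0 < v" "0 < w" "v ^ 3 + b * v\<^sup>2 + c * v + d = 0" "w ^ 3 + b * w\<^sup>2 + c * w + d = 0"
  shows "v = w"
  using assms(3-)
proof (induction v w rule: linorder_wlog)
  case (sym v w)
  then show ?case by blast
next
  case (le v w)
  show ?case
  proof (rule ccontr)
    assume "v \<noteq> w"
    then have vw: "v < w" using le by simp
    from bc show False
    proof
      assume b: "0 \<le> b"
      have "0 = w * (v ^ 3 + b * v\<^sup>2 + c * v + d) - v * (w ^ 3 + b * w\<^sup>2 + c * w + d)" using le by simp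
      also have "\<dots> = (v - w) * (v * w * (v + w + b) - d)"
        by (simp add: power2_eq_square power3_eq_cube algebra_simps)
      finally have "v * w * (v + w + b) = d" using vw by simp
      moreover have "0 < v * w * (v + w + b)" using le b by simp
      ultimately show False using dc by simp
    next
      assume c: "c \<le> 0"
      have "0 = w\<^sup>2 * (v ^ 3 + b * v\<^sup>2 + c * v + d) - v\<^sup>2 * (w ^ 3 + b * w\<^sup>2 + c * w + d)" using le by simp
      also have "\<dots> = (v - w) * (v\<^sup>2 * w\<^sup>2 - c * (v * w) - d * (v + w))"
        by (simp add: power2_eq_square power3_eq_cube algebra_simps)
      finally have "v\<^sup>2 * w\<^sup>2 - c * (v * w) - d * (v + w) = 0" using vw by simp
      moreover have "0 < v\<^sup>2 * w\<^sup>2" "c * (v * w) \<le> 0" "d * (v + w) \<le> 0"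
        using le c dc by (auto intro!: mult_nonpos_nonneg)
      ultimately show False by linarith
    qed
  qed
qed

text \<open>The cubic is negative somewhere just to the right of 1 and positive far out, which gives
  a root; a single sign change in the expansion around 1 makes it unique.\<close>

lemma char_roots_singleton:
  assumes "\<mu> * lam - \<mu> - lam < 0 \<or> \<mu> * lam - \<mu> - lam = 0 \<and> 1 < \<mu>"
  obtains u where "char_roots \<mu> lam = {u}" "1 < u"
proof -
  define b c d where "b = 3 - 2 * \<mu> - lam" and "c = 2 * ((\<mu> - 1) * (lam - 2) - 1)"
    and "d = 2 * (\<mu> * lam - \<mu> - lam)"
  have S: "char_cubic \<mu> lam u = (u - 1) ^ 3 + b * (u - 1)\<^sup>2 + c * (u - 1) + d" for u
    using char_cubic_shift[of \<mu> lam "u - 1"] by (simp add: b_def c_def d_def)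
  \<comment> \<open>This relation links the two lowest coefficients: at \<open>d = 0\<close> the
    condition \<open>1 < \<mu>\<close> says exactly that \<open>c < 0\<close>.\<close>
  have cd: "c = d + 2 * (1 - \<mu>)" by (simp add: c_def d_def algebra_simps)
  have dc: "d < 0 \<or> d = 0 \<and> c < 0" using assms by (auto simp: cd d_def)
  have bc: "0 \<le> b \<or> c \<le> 0"
  proof (rule ccontr)
    \<comment> \<open>Two extra sign changes would need \<open>b < 0 < c\<close>. Then
      \<open>\<mu> < 1\<close> and \<open>1 < lam\<close>, so \<open>c > 0\<close> forces
      \<open>\<mu> < 0\<close> and \<open>lam < 2\<close>, whence \<open>b > 0\<close>.\<close>
    assume "\<not> ?thesis"
    then have n: "b < 0" "0 < c" by auto
    then have mu: "\<mu> < 1" using dc cd by auto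
    have lam1: "1 < lam" using n mu by (simp add: b_def)
    have "1 < (1 - \<mu>) * (2 - lam)" using n by (simp add: c_def algebra_simps)
    moreover have "(1 - \<mu>) * (2 - lam) \<le> (1 - \<mu>) * 1" using mu lam1 by (intro mult_left_mono) auto
    moreover have "0 < 2 - lam"
      using mu calculation(1) zero_less_mult_pos[of "1 - \<mu>" "2 - lam"] by simp
    ultimately show False using n by (simp add: b_def)
  qed
  obtain s where s: "1 < s" "char_cubic \<mu> lam s < 0"
  proof (cases "d < 0")
    case True
    have "(char_cubic \<mu> lam \<longlongrightarrow> char_cubic \<mu> lam 1) (at_right 1)"
      using continuous_on_char_cubic[of UNIV \<mu> lam]
      by (simp add: continuous_on_def filterlim_at_split)
    then have "\<forall>\<^sub>F s in at_right 1. char_cubic \<mu> lam s < 0"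
      by (rule order_tendstoD) (use True in \<open>simp add: S\<close>)
    then have "\<forall>\<^sub>F s in at_right 1. char_cubic \<mu> lam s < 0 \<and> 1 < s"
      by (intro eventually_conj) (auto simp: eventually_at_filter)
    then show ?thesis using that eventually_happens'[OF trivial_limit_at_right_real] by blast
  next
    case False
    then have d0: "d = 0" "c < 0" using dc by auto
    \<comment> \<open>When \<open>d = 0\<close> the cubic vanishes at the threshold; the factor
      \<open>v\<close> is split off and the remaining quadratic equals \<open>c < 0\<close> at
      0.\<close>
    have "((\<lambda>v. v\<^sup>2 + b * v + c) \<longlongrightarrow> 0\<^sup>2 + b * 0 + c) (at_right 0)"
      by (intro tendsto_intros)
    then have "\<forall>\<^sub>F v in at_right 0. v\<^sup>2 + b * v + c < 0"
      by (rule order_tendstoD) (use d0 in simp)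
    then have "\<forall>\<^sub>F v in at_right 0. v\<^sup>2 + b * v + c < 0 \<and> 0 < v"
      by (intro eventually_conj) (auto simp: eventually_at_filter)
    then obtain v where v: "v\<^sup>2 + b * v + c < 0" "0 < v"
      using eventually_happens'[OF trivial_limit_at_right_real] by blast
    then have "v * (v\<^sup>2 + b * v + c) < 0" by (rule mult_pos_neg[rotated])
    then show ?thesis using that[of "1 + v"] v d0
      by (simp add: S power2_eq_square power3_eq_cube algebra_simps)
  qed
  obtain t where t: "s < t" "0 < char_cubic \<mu> lam t" by (rule char_cubic_eventually_pos)
  obtain u where u: "s < u" "char_cubic \<mu> lam u = 0"
    using char_cubic_root_between[of s t \<mu> lam] s t by (auto simp: mult_neg_pos)
  have "w = u" if "w \<in> char_roots \<mu> lam" for w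
    using cubic_unique_pos_root[OF bc dc, of "w - 1" "u - 1"] that s u
    by (auto simp: char_roots_def S)
  then have "char_roots \<mu> lam = {u}" using s u by (auto simp: char_roots_def)
  then show ?thesis using that s u by auto
qed

text \<open>The hypotheses place both couplings below 1, and then no coefficient of the expansion
  around 1 is negative.\<close>

lemma char_roots_empty:
  assumes "0 \<le> \<mu> * lam - \<mu> - lam" "\<mu> < 1"
  shows "char_roots \<mu> lam = {}"
proof -
  have "1 \<le> (1 - \<mu>) * (1 - lam)" using assms by (simp add: algebra_simps)
  then have "lam < 1" using assms zero_less_mult_pos[of "1 - \<mu>" "1 - lam"] by simp
  have "char_cubic \<mu> lam u > 0" if "1 < u" for u
  proof -
    define v where "v = u - 1"
    have v: "0 < v" using that by (simp add: v_def)
    have "0 < (3 - 2 * \<mu> - lam) * v\<^sup>2" using assms v \<open>lam < 1\<close> by simp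
    moreover have "0 < 2 * ((\<mu> - 1) * (lam - 2) - 1) * v" using assms v
      by (intro mult_pos_pos) (auto simp: algebra_simps)
    moreover have "0 < v ^ 3" using v by simp
    moreover have "0 \<le> 2 * (\<mu> * lam - \<mu> - lam)" using assms by simp
    ultimately have "0 < char_cubic \<mu> lam (1 + v)" unfolding char_cubic_shift by linarith
    then show ?thesis by (simp add: v_def)
  qed
  then show ?thesis by (force simp: char_roots_def)
qed

text \<open>\<open>\<mu> * lam - \<mu> - lam\<close> equals
  \<open>(\<mu> - 1) * (lam - 1) - 1\<close>, so its zero set is a hyperbola centred at
  \<open>(1, 1)\<close>; \<open>1 < \<mu>\<close> selects the region beyond the upper
  branch.\<close>

lemma hyperbola_upper_branch:
  fixes \<mu> lam :: real
  assumes "0 < \<mu> * lam - \<mu> - lam" "1 < \<mu>"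
  shows "1 < lam" "0 < \<mu> * lam + \<mu> + lam"
proof -
  have "1 < (\<mu> - 1) * (lam - 1)" using assms by (simp add: algebra_simps)
  then show "1 < lam" using assms zero_less_mult_pos[of "\<mu> - 1" "lam - 1"] by simp
  then show "0 < \<mu> * lam + \<mu> + lam" using assms by (intro add_pos_pos mult_pos_pos) auto
qed

text \<open>The cubic is negative at 0, positive at 1, negative at both rank-one roots
  \<open>v\<close> and \<open>w\<close>, and positive far out. The resulting three sign changes
  account for all roots of a cubic.\<close>

lemma char_roots_pair:
  assumes "0 < \<mu> * lam - \<mu> - lam" "1 < \<mu>"
    and v: "v \<in> char_roots \<mu> 0" and w: "w \<in> char_roots 0 lam"
  obtains u1 u2 where "char_roots \<mu> lam = {u1, u2}" "1 < u1" "u1 < min v w" "max v w < u2"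
proof -
  have lam: "1 < lam" by (rule hyperbola_upper_branch(1)[OF assms(1,2)])
  have v1: "1 < v" "char_cubic \<mu> 0 v = 0" and w1: "1 < w" "char_cubic 0 lam w = 0"
    using v w by (auto simp: char_roots_def)
  \<comment> \<open>The equation of \<open>v\<close> for \<open>lam = 0\<close> reduces the full
    cubic at \<open>v\<close> to \<open>- 2 * lam\<close>.\<close>
  have "v * (v * (v - 2 * \<mu>) - 1) = 0" using v1 by (simp add: char_cubic_def algebra_simps)
  then have "v * (v - 2 * \<mu>) = 1" using v1 by simp
  then have "char_cubic \<mu> lam v = - 2 * lam" by (simp add: char_cubic_def)
  then have Sv: "char_cubic \<mu> lam v < 0" using lam by simp
  \<comment> \<open>Multiplying the full cubic by \<open>w\<close> makes the equation for
    \<open>\<mu> = 0\<close> substitutable; the result is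
    \<open>- (2 * \<mu> * (w + lam))\<close>.\<close>
  have "w * (w * (w - lam)) = w + lam" using w1 by (simp add: char_cubic_def algebra_simps)
  moreover have "w * char_cubic \<mu> lam w = w * (w * (w - lam)) * (w - 2 * \<mu>) - w * (w + lam)"
    by (simp add: char_cubic_def algebra_simps)
  ultimately have "w * char_cubic \<mu> lam w = (w + lam) * (w - 2 * \<mu>) - w * (w + lam)" by simp
  also have "\<dots> = - (2 * \<mu> * (w + lam))" by (simp add: algebra_simps)
  also have "\<dots> < 0" using assms lam w1 by simp
  finally have Sw: "char_cubic \<mu> lam w < 0" using w1 by (simp add: mult_less_0_iff)
  have S1: "0 < char_cubic \<mu> lam 1" using char_cubic_shift[of \<mu> lam 0] assms by simp
  have S0: "char_cubic \<mu> lam 0 < 0" using lam by (simp add: char_cubic_def)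
  have Smin: "char_cubic \<mu> lam (min v w) < 0" and Smax: "char_cubic \<mu> lam (max v w) < 0"
    using Sv Sw by (auto simp: min_def max_def)
  obtain t where t: "max v w < t" "0 < char_cubic \<mu> lam t" by (rule char_cubic_eventually_pos)
  \<comment> \<open>This root gives no eigenvalue, but it takes up one of the three roots, so the
    root sum leaves only \<open>u1\<close> and \<open>u2\<close> above 1.\<close>
  obtain u0 where u0: "0 < u0" "u0 < 1" "char_cubic \<mu> lam u0 = 0"
    using char_cubic_root_between[of 0 1 \<mu> lam] S0 S1 by (auto simp: mult_neg_pos)
  obtain u1 where u1: "1 < u1" "u1 < min v w" "char_cubic \<mu> lam u1 = 0"
    using char_cubic_root_between[of 1 "min v w" \<mu> lam] Smin S1 v1 w1 mult_pos_neg by (metis min_less_iff_conj)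
  obtain u2 where u2: "max v w < u2" "char_cubic \<mu> lam u2 = 0"
    using char_cubic_root_between[of "max v w" t \<mu> lam] Smax t mult_neg_pos by metis
  have u12: "u1 < u2" using u1 u2 by linarith
  have "u = u2" if "u \<in> char_roots \<mu> lam" "u \<noteq> u1" for u
    using char_cubic_root_sum[of u0 u1 u \<mu> lam] char_cubic_root_sum[of u0 u1 u2 \<mu> lam] that u0 u1 u2 u12
    by (auto simp: char_roots_def)
  then have "char_roots \<mu> lam = {u1, u2}" using u1 u2 u12 by (auto simp: char_roots_def)
  then show ?thesis using that u1 u2 by blast
qed

section \<open>Eigenvalues outside the essential spectrum\<close>

text \<open>For \<open>u > 1\<close>, \<open>1 + joukowski u\<close> runs over the half-line above 2
  and \<open>1 - joukowski u\<close> over the half-line below 0.\<close>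

definition joukowski :: "real \<Rightarrow> real" where
  "joukowski u = (u + 1 / u) / 2"

lemma joukowski_strict_mono:
  assumes "1 < u" "u < v"
  shows "joukowski u < joukowski v"
proof -
  have "joukowski v - joukowski u = (v - u) * (1 - 1 / (u * v)) / 2"
    using assms by (simp add: joukowski_def field_simps)
  moreover have "1 < u * v" using assms less_1_mult[of u v] by simp
  then have "0 < (v - u) * (1 - 1 / (u * v)) / 2" using assms by simp
  ultimately show ?thesis by linarith
qed

lemma joukowski_gt_1:
  assumes "1 < u"
  shows "1 < joukowski u"
proof -
  have "joukowski u - 1 = (u - 1)\<^sup>2 / (2 * u)"
    using assms by (simp add: joukowski_def field_simps power2_eq_square)
  moreover have "0 < (u - 1)\<^sup>2 / (2 * u)" using assms by simp
  ultimately show ?thesis by linarith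
qed

lemma joukowski_surj:
  assumes "1 < s"
  obtains u where "1 < u" "joukowski u = s"
proof -
  have s2: "1 < s\<^sup>2" using assms by simp
  \<comment> \<open>\<open>s + r\<close> is the larger solution of \<open>u + 1 / u = 2 * s\<close>,
    with reciprocal \<open>s - r\<close>.\<close>
  define r where "r = sqrt (s\<^sup>2 - 1)"
  have r: "0 < r" "r\<^sup>2 = s\<^sup>2 - 1" using s2 by (simp_all add: r_def)
  have "(s + r) * (s - r) = 1" using r(2) by (simp add: algebra_simps power2_eq_square)
  then have "1 / (s + r) = s - r" using assms r by (simp add: field_simps)
  then show ?thesis using that[of "s + r"] assms r by (simp add: joukowski_def)
qed

section \<open>Correspondence between eigenvalues and roots of the cubic\<close>

lemma fredholm_det_eq_char_cubic:
  assumes "1 < u"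
  shows "fredholm_det \<mu> lam (- 1 / u) = char_cubic \<mu> lam u / (u * (u\<^sup>2 - 1))"
proof -
  define x where x: "x = - 1 / u"
  define m0 m1 m2 where "m0 = 2 * x / (1 - x\<^sup>2)" and "m1 = 2 * x\<^sup>2 / (1 - x\<^sup>2)"
    and "m2 = x * (1 + x\<^sup>2) / (1 - x\<^sup>2)"
  have u2: "u\<^sup>2 - 1 \<noteq> 0" using assms by (simp add: power2_eq_1_iff)
  have d: "1 - x\<^sup>2 = (u\<^sup>2 - 1) / u\<^sup>2" using assms by (simp add: x field_simps power2_eq_square)
  have m0: "m0 = - 2 * u / (u\<^sup>2 - 1)" and m1: "m1 = 2 / (u\<^sup>2 - 1)" and m2: "m2 = - (u\<^sup>2 + 1) / (u * (u\<^sup>2 - 1))"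
    unfolding m0_def m1_def m2_def d using assms u2 by (simp_all add: x field_simps power2_eq_square)
  \<comment> \<open>Treating \<open>u\<^sup>2 - 1\<close> as a variable \<open>e\<close> with
    \<open>u * u = e + 1\<close> exposes the common factor \<open>e\<close> of the
    numerator.\<close>
  define e where "e = u\<^sup>2 - 1"
  have e: "e \<noteq> 0" "u\<^sup>2 + 1 = e + 2" using u2 by (simp_all add: e_def)
  have eu: "u * u = e + 1" by (simp add: e_def power2_eq_square)
  have "fredholm_det \<mu> lam x = (1 + \<mu> * m0) * (1 + lam * m2) - (lam * m1) * (\<mu> * m1)"
    by (simp only: fredholm_det_def m0_def m1_def m2_def)
  also have "\<dots> = ((e - 2 * \<mu> * u) * (u * e - lam * (e + 2)) - 4 * \<mu> * lam * u) / (u * e\<^sup>2)"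
    unfolding m0 m1 m2 e(2) e_def[symmetric] using assms e(1) by (simp add: field_simps power2_eq_square)
  also have "(e - 2 * \<mu> * u) * (u * e - lam * (e + 2)) - 4 * \<mu> * lam * u = e * char_cubic \<mu> lam u"
    unfolding char_cubic_def using eu by algebra
  also have "e * char_cubic \<mu> lam u / (u * e\<^sup>2) = char_cubic \<mu> lam u / (u * e)"
    using e(1) by (simp add: power2_eq_square)
  finally show ?thesis by (simp only: e_def x)
qed

lemma is_eigenvalue_above_iff:
  assumes "1 < u"
  shows "is_eigenvalue (H_op \<mu> lam) (complex_of_real (1 + joukowski u)) \<longleftrightarrow> char_cubic \<mu> lam u = 0"
proof -
  define x where "x = - 1 / u"
  have x: "\<bar>x\<bar> < 1" "x \<noteq> 0" using assms by (simp_all add: x_def)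
  have z: "1 - (x + 1 / x) / 2 = 1 + joukowski u" using assms by (simp add: x_def joukowski_def field_simps)
  have "u * (u\<^sup>2 - 1) \<noteq> 0" using assms by (simp add: power2_eq_1_iff)
  then have "fredholm_det \<mu> lam x = 0 \<longleftrightarrow> char_cubic \<mu> lam u = 0"
    unfolding x_def fredholm_det_eq_char_cubic[OF assms] by (metis divide_eq_0_iff)
  then show ?thesis using is_eigenvalue_iff_fredholm_det[OF x, of \<mu> lam] unfolding z by simp
qed

text \<open>Changing the sign of \<open>x\<close> reflects \<open>z\<close> to \<open>2 - z\<close>,
  and \<open>fredholm_det_minus\<close> turns this into a sign change of both couplings.\<close>

lemma is_eigenvalue_below_iff:
  assumes "1 < u"
  shows "is_eigenvalue (H_op \<mu> lam) (complex_of_real (1 - joukowski u)) \<longleftrightarrow> char_cubic (- \<mu>) (- lam) u = 0"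
proof -
  define x where "x = - 1 / u"
  have x: "\<bar>- x\<bar> < 1" "- x \<noteq> 0" using assms by (simp_all add: x_def)
  have z: "1 - (- x + 1 / - x) / 2 = 1 - joukowski u" using assms by (simp add: x_def joukowski_def field_simps)
  have "u * (u\<^sup>2 - 1) \<noteq> 0" using assms by (simp add: power2_eq_1_iff)
  then have "fredholm_det \<mu> lam (- x) = 0 \<longleftrightarrow> char_cubic (- \<mu>) (- lam) u = 0"
    unfolding fredholm_det_minus x_def fredholm_det_eq_char_cubic[OF assms] by (metis divide_eq_0_iff)
  then show ?thesis using is_eigenvalue_iff_fredholm_det[OF x, of \<mu> lam] unfolding z by simp
qed

lemma eigenvalues_above_eq:
  "eigenvalues_above (H_op \<mu> lam) = (\<lambda>u. complex_of_real (1 + joukowski u)) ` char_roots \<mu> lam"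
proof (intro set_eqI iffI)
  fix z assume "z \<in> eigenvalues_above (H_op \<mu> lam)"
  then obtain y where y: "is_eigenvalue (H_op \<mu> lam) z" "z = complex_of_real y" "2 < y"
    by (auto simp: eigenvalues_above_def)
  moreover obtain u where "1 < u" "joukowski u = y - 1" by (rule joukowski_surj[of "y - 1"]) (use y in auto)
  ultimately show "z \<in> (\<lambda>u. complex_of_real (1 + joukowski u)) ` char_roots \<mu> lam"
    using is_eigenvalue_above_iff[of u \<mu> lam] by (intro image_eqI[of _ _ u]) (auto simp: char_roots_def)
next
  fix z assume "z \<in> (\<lambda>u. complex_of_real (1 + joukowski u)) ` char_roots \<mu> lam"
  then obtain u where "1 < u" "char_cubic \<mu> lam u = 0" "z = complex_of_real (1 + joukowski u)"
    by (auto simp: char_roots_def)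
  then show "z \<in> eigenvalues_above (H_op \<mu> lam)"
    using is_eigenvalue_above_iff[of u \<mu> lam] joukowski_gt_1[of u]
    unfolding eigenvalues_above_def by (intro CollectI conjI image_eqI[of _ _ "1 + joukowski u"]) auto
qed

lemma eigenvalues_below_eq:
  "eigenvalues_below (H_op \<mu> lam) = (\<lambda>u. complex_of_real (1 - joukowski u)) ` char_roots (- \<mu>) (- lam)"
proof (intro set_eqI iffI)
  fix z assume "z \<in> eigenvalues_below (H_op \<mu> lam)"
  then obtain y where y: "is_eigenvalue (H_op \<mu> lam) z" "z = complex_of_real y" "y < 0"
    by (auto simp: eigenvalues_below_def)
  moreover obtain u where "1 < u" "joukowski u = 1 - y" by (rule joukowski_surj[of "1 - y"]) (use y in auto)
  ultimately show "z \<in> (\<lambda>u. complex_of_real (1 - joukowski u)) ` char_roots (- \<mu>) (- lam)"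
    using is_eigenvalue_below_iff[of u \<mu> lam] by (intro image_eqI[of _ _ u]) (auto simp: char_roots_def)
next
  fix z assume "z \<in> (\<lambda>u. complex_of_real (1 - joukowski u)) ` char_roots (- \<mu>) (- lam)"
  then obtain u where "1 < u" "char_cubic (- \<mu>) (- lam) u = 0" "z = complex_of_real (1 - joukowski u)"
    by (auto simp: char_roots_def)
  then show "z \<in> eigenvalues_below (H_op \<mu> lam)"
    using is_eigenvalue_below_iff[of u \<mu> lam] joukowski_gt_1[of u]
    unfolding eigenvalues_below_def by (intro CollectI conjI image_eqI[of _ _ "1 - joukowski u"]) auto
qed

text \<open>Since eigenvalues are real, those off \<open>[0, 2]\<close> lie on one of the two
  half-lines.\<close>

lemma eigenvalues_outside_eq:
  "eigenvalues_outside (H_op \<mu> lam) = eigenvalues_below (H_op \<mu> lam) \<union> eigenvalues_above (H_op \<mu> lam)"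
proof -
  have "z \<in> complex_of_real ` {..<0} \<or> z \<in> complex_of_real ` {2<..} \<longleftrightarrow> z \<notin> complex_of_real ` {0..2}"
    if "is_eigenvalue (H_op \<mu> lam) z" for z
  proof -
    obtain y where "z = complex_of_real y" using eigenvalue_real[OF \<open>is_eigenvalue (H_op \<mu> lam) z\<close>] by (auto elim: Reals_cases)
    then show ?thesis by (auto simp: image_iff)
  qed
  then show ?thesis unfolding eigenvalues_outside_def eigenvalues_below_def eigenvalues_above_def by blast
qed

section \<open>Eigenvalue counts on each side and the rank-one eigenvalues\<close>

lemma eigenvalues_above_singleton:
  assumes "\<mu> * lam - \<mu> - lam < 0 \<or> \<mu> * lam - \<mu> - lam = 0 \<and> 1 < \<mu>"
  obtains u where "char_roots \<mu> lam = {u}" "1 < u"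
    "eigenvalues_above (H_op \<mu> lam) = {complex_of_real (1 + joukowski u)}"
  using char_roots_singleton[OF assms] by (metis eigenvalues_above_eq image_empty image_insert)

lemma eigenvalues_below_singleton:
  assumes "\<mu> * lam + \<mu> + lam < 0 \<or> \<mu> * lam + \<mu> + lam = 0 \<and> \<mu> < - 1"
  obtains u where "char_roots (- \<mu>) (- lam) = {u}" "1 < u"
    "eigenvalues_below (H_op \<mu> lam) = {complex_of_real (1 - joukowski u)}"
proof -
  have "(- \<mu>) * (- lam) - (- \<mu>) - (- lam) < 0 \<or> (- \<mu>) * (- lam) - (- \<mu>) - (- lam) = 0 \<and> 1 < - \<mu>"
    using assms by auto
  from char_roots_singleton[OF this] show ?thesis
    by (metis that eigenvalues_below_eq image_empty image_insert)
qed

lemma eigenvalues_above_empty: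
  assumes "0 \<le> \<mu> * lam - \<mu> - lam" "\<mu> < 1"
  shows "eigenvalues_above (H_op \<mu> lam) = {}"
  using char_roots_empty[OF assms] by (simp add: eigenvalues_above_eq)

lemma eigenvalues_below_empty:
  assumes "0 \<le> \<mu> * lam + \<mu> + lam" "- 1 < \<mu>"
  shows "eigenvalues_below (H_op \<mu> lam) = {}"
  using char_roots_empty[of "- \<mu>" "- lam"] assms by (simp add: eigenvalues_below_eq)

text \<open>For \<open>lam = 0\<close> the sign quantities are \<open>- \<mu>\<close> and
  \<open>\<mu>\<close>, giving one eigenvalue above and none below; hence the definite description
  in \<open>zeta_mu\<close> is well defined.\<close>

lemma zeta_mu_pos:
  assumes "0 < \<mu>"
  obtains v where "v \<in> char_roots \<mu> 0" "zeta_mu \<mu> = 1 + joukowski v"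
proof -
  obtain v where v: "char_roots \<mu> 0 = {v}" "eigenvalues_above (H_op \<mu> 0) = {complex_of_real (1 + joukowski v)}"
    by (rule eigenvalues_above_singleton[of \<mu> 0]) (use assms in auto)
  then have "eigenvalues_outside (H_op \<mu> 0) = {complex_of_real (1 + joukowski v)}"
    using eigenvalues_below_empty[of \<mu> 0] assms by (simp add: eigenvalues_outside_eq)
  then have "zeta_mu \<mu> = 1 + joukowski v"
    unfolding zeta_mu_def by (simp only: singleton_iff of_real_eq_iff the_eq_trivial)
  then show ?thesis using that v by simp
qed

lemma zeta_lambda_pos:
  assumes "0 < lam"
  obtains v where "v \<in> char_roots 0 lam" "zeta_lambda lam = 1 + joukowski v"
proof -
  obtain v where v: "char_roots 0 lam = {v}" "eigenvalues_above (H_op 0 lam) = {complex_of_real (1 + joukowski v)}"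
    by (rule eigenvalues_above_singleton[of 0 lam]) (use assms in auto)
  then have "eigenvalues_outside (H_op 0 lam) = {complex_of_real (1 + joukowski v)}"
    using eigenvalues_below_empty[of 0 lam] assms by (simp add: eigenvalues_outside_eq)
  then have "zeta_lambda lam = 1 + joukowski v"
    unfolding zeta_lambda_def by (simp only: singleton_iff of_real_eq_iff the_eq_trivial)
  then show ?thesis using that v by simp
qed

lemma zeta_mu_neg:
  assumes "\<mu> < 0"
  obtains v where "v \<in> char_roots (- \<mu>) 0" "zeta_mu \<mu> = 1 - joukowski v"
proof -
  obtain v where v: "char_roots (- \<mu>) 0 = {v}" "eigenvalues_below (H_op \<mu> 0) = {complex_of_real (1 - joukowski v)}"
    by (rule eigenvalues_below_singleton[of \<mu> 0]) (use assms in auto)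
  then have "eigenvalues_outside (H_op \<mu> 0) = {complex_of_real (1 - joukowski v)}"
    using eigenvalues_above_empty[of \<mu> 0] assms by (simp add: eigenvalues_outside_eq)
  then have "zeta_mu \<mu> = 1 - joukowski v"
    unfolding zeta_mu_def by (simp only: singleton_iff of_real_eq_iff the_eq_trivial)
  then show ?thesis using that v by simp
qed

lemma zeta_lambda_neg:
  assumes "lam < 0"
  obtains v where "v \<in> char_roots 0 (- lam)" "zeta_lambda lam = 1 - joukowski v"
proof -
  obtain v where v: "char_roots 0 (- lam) = {v}" "eigenvalues_below (H_op 0 lam) = {complex_of_real (1 - joukowski v)}"
    by (rule eigenvalues_below_singleton[of 0 lam]) (use assms in auto)
  then have "eigenvalues_outside (H_op 0 lam) = {complex_of_real (1 - joukowski v)}"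
    using eigenvalues_above_empty[of 0 lam] assms by (simp add: eigenvalues_outside_eq)
  then have "zeta_lambda lam = 1 - joukowski v"
    unfolding zeta_lambda_def by (simp only: singleton_iff of_real_eq_iff the_eq_trivial)
  then show ?thesis using that v by simp
qed

section \<open>Interlacing in the two-eigenvalue regions\<close>

lemma two_eigenvalues_above:
  assumes "0 < \<mu> * lam - \<mu> - lam" "1 < \<mu>"
  shows "eigenvalues_below (H_op \<mu> lam) = {}"
    and "\<exists>\<zeta>1 \<zeta>2. eigenvalues_outside (H_op \<mu> lam) = {complex_of_real \<zeta>1, complex_of_real \<zeta>2} \<and>
           2 < \<zeta>1 \<and> \<zeta>1 < zeta_min \<mu> lam \<and> zeta_max \<mu> lam < \<zeta>2"
proof -
  note lam = hyperbola_upper_branch[OF assms]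
  show below: "eigenvalues_below (H_op \<mu> lam) = {}"
    using lam assms by (intro eigenvalues_below_empty) auto
  obtain v where v: "v \<in> char_roots \<mu> 0" "zeta_mu \<mu> = 1 + joukowski v"
    by (rule zeta_mu_pos[of \<mu>]) (use assms in auto)
  obtain w where w: "w \<in> char_roots 0 lam" "zeta_lambda lam = 1 + joukowski w"
    by (rule zeta_lambda_pos[of lam]) (use lam in auto)
  obtain u1 u2 where u: "char_roots \<mu> lam = {u1, u2}" "1 < u1" "u1 < min v w" "max v w < u2"
    by (rule char_roots_pair[OF assms v(1) w(1)])
  have "1 < v" "1 < w" using v w by (auto simp: char_roots_def)
  \<comment> \<open>Monotonicity carries the interlacing of the roots over to the
    eigenvalues.\<close>
  then have "joukowski u1 < joukowski v" "joukowski u1 < joukowski w"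
      "joukowski v < joukowski u2" "joukowski w < joukowski u2"
    using u by (auto intro!: joukowski_strict_mono)
  then show "\<exists>\<zeta>1 \<zeta>2. eigenvalues_outside (H_op \<mu> lam) = {complex_of_real \<zeta>1, complex_of_real \<zeta>2} \<and>
           2 < \<zeta>1 \<and> \<zeta>1 < zeta_min \<mu> lam \<and> zeta_max \<mu> lam < \<zeta>2"
    using joukowski_gt_1[OF u(2)] below
    by (intro exI[of _ "1 + joukowski u1"] exI[of _ "1 + joukowski u2"])
      (simp add: eigenvalues_outside_eq eigenvalues_above_eq u(1) zeta_min_def zeta_max_def v w)
qed

text \<open>The case above 2 with both couplings negated. As \<open>1 - joukowski u\<close>
  decreases in \<open>u\<close>, the larger root \<open>u2\<close> gives the smaller
  eigenvalue.\<close>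

lemma two_eigenvalues_below:
  assumes "0 < \<mu> * lam + \<mu> + lam" "\<mu> < - 1"
  shows "eigenvalues_above (H_op \<mu> lam) = {}"
    and "\<exists>\<zeta>1 \<zeta>2. eigenvalues_outside (H_op \<mu> lam) = {complex_of_real \<zeta>1, complex_of_real \<zeta>2} \<and>
           \<zeta>1 < zeta_min \<mu> lam \<and> zeta_max \<mu> lam < \<zeta>2 \<and> \<zeta>2 < 0"
proof -
  have neg: "0 < (- \<mu>) * (- lam) - (- \<mu>) - (- lam)" "1 < - \<mu>" using assms by auto
  note lam = hyperbola_upper_branch[OF neg]
  show above: "eigenvalues_above (H_op \<mu> lam) = {}"
    using lam assms by (intro eigenvalues_above_empty) auto
  obtain v where v: "v \<in> char_roots (- \<mu>) 0" "zeta_mu \<mu> = 1 - joukowski v"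
    by (rule zeta_mu_neg[of \<mu>]) (use assms in auto)
  obtain w where w: "w \<in> char_roots 0 (- lam)" "zeta_lambda lam = 1 - joukowski w"
    by (rule zeta_lambda_neg[of lam]) (use lam in auto)
  obtain u1 u2 where u: "char_roots (- \<mu>) (- lam) = {u1, u2}" "1 < u1" "u1 < min v w" "max v w < u2"
    by (rule char_roots_pair[OF neg v(1) w(1)])
  have "1 < v" "1 < w" using v w by (auto simp: char_roots_def)
  then have "joukowski u1 < joukowski v" "joukowski u1 < joukowski w"
      "joukowski v < joukowski u2" "joukowski w < joukowski u2"
    using u by (auto intro!: joukowski_strict_mono)
  then show "\<exists>\<zeta>1 \<zeta>2. eigenvalues_outside (H_op \<mu> lam) = {complex_of_real \<zeta>1, complex_of_real \<zeta>2} \<and>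
           \<zeta>1 < zeta_min \<mu> lam \<and> zeta_max \<mu> lam < \<zeta>2 \<and> \<zeta>2 < 0"
    using joukowski_gt_1[OF u(2)] above
    by (intro exI[of _ "1 - joukowski u2"] exI[of _ "1 - joukowski u1"])
      (simp add: eigenvalues_outside_eq eigenvalues_below_eq u(1) zeta_min_def zeta_max_def v w insert_commute)
qed

text \<open>A positive sign alone does not tell which branch of the hyperbola is meant. Beyond the
  lower branch, \<open>\<mu> < - 1\<close>, the other quantity would also be positive, contrary to
  the second hypothesis; at \<open>\<mu> = - 1\<close> the first quantity is negative.\<close>

lemma hyperbola_branches_disjoint:
  fixes \<mu> lam :: real
  assumes "0 < \<mu> * lam + \<mu> + lam" "\<mu> * lam - \<mu> - lam < 0 \<or> \<mu> * lam - \<mu> - lam = 0 \<and> 1 < \<mu>"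
  shows "- 1 < \<mu>"
proof (rule ccontr)
  assume n: "\<not> - 1 < \<mu>"
  have "\<mu> \<noteq> - 1" using assms by auto
  then have "\<mu> < - 1" using n by simp
  then have "0 < \<mu> * lam - \<mu> - lam"
    using hyperbola_upper_branch(2)[of "- \<mu>" "- lam"] assms by simp
  then show False using assms(2) by auto
qed

section \<open>Combination over the five regions\<close>

theorem theorem5p5:
  fixes \<mu> lam B0 B2 :: real
  assumes "B0 > 0" and "B2 > 0"
  shows
    "((\<mu>, lam) \<in> G02 B0 B2 \<longrightarrow>
        eigenvalues_below (H_op \<mu> lam) = {} \<and>
        (\<exists>\<zeta>1 \<zeta>2 :: real.
           eigenvalues_outside (H_op \<mu> lam) = {complex_of_real \<zeta>1, complex_of_real \<zeta>2} \<and>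
           2 < \<zeta>1 \<and> \<zeta>1 < zeta_min \<mu> lam \<and> zeta_min \<mu> lam \<le> zeta_max \<mu> lam \<and> zeta_max \<mu> lam < \<zeta>2)) \<and>
     ((\<mu>, lam) \<in> G01 B0 B2 \<longrightarrow>
        eigenvalues_below (H_op \<mu> lam) = {} \<and>
        (\<exists>\<zeta>2 :: real.
           eigenvalues_outside (H_op \<mu> lam) = {complex_of_real \<zeta>2} \<and> \<zeta>2 > 2)) \<and>
     ((\<mu>, lam) \<in> G11 B0 B2 \<longrightarrow>
        (\<exists>\<zeta>1 \<zeta>2 :: real.
           eigenvalues_outside (H_op \<mu> lam) = {complex_of_real \<zeta>1, complex_of_real \<zeta>2} \<and>
           \<zeta>1 < 0 \<and> \<zeta>2 > 2)) \<and>
     ((\<mu>, lam) \<in> G10 B0 B2 \<longrightarrow>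
        (\<exists>\<zeta>1 :: real.
           eigenvalues_outside (H_op \<mu> lam) = {complex_of_real \<zeta>1} \<and> \<zeta>1 < 0) \<and>
        eigenvalues_above (H_op \<mu> lam) = {}) \<and>
     ((\<mu>, lam) \<in> G20 B0 B2 \<longrightarrow>
        (\<exists>\<zeta>1 \<zeta>2 :: real.
           eigenvalues_outside (H_op \<mu> lam) = {complex_of_real \<zeta>1, complex_of_real \<zeta>2} \<and>
           \<zeta>1 < zeta_min \<mu> lam \<and> zeta_min \<mu> lam \<le> zeta_max \<mu> lam \<and> zeta_max \<mu> lam < \<zeta>2 \<and> \<zeta>2 < 0) \<and>
        eigenvalues_above (H_op \<mu> lam) = {})"
proof -
  define p where "p = \<mu> * lam - \<mu> - lam"
  define m where "m = \<mu> * lam + \<mu> + lam"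
  have C: "(0 < C_plus B2 \<mu> lam) = (0 < p)" "(C_plus B2 \<mu> lam < 0) = (p < 0)" "(C_plus B2 \<mu> lam = 0) = (p = 0)"
      "(0 < C_minus B0 \<mu> lam) = (0 < m)" "(C_minus B0 \<mu> lam < 0) = (m < 0)" "(C_minus B0 \<mu> lam = 0) = (m = 0)"
    using assms by (simp_all add: C_plus_def C_minus_def p_def m_def zero_less_mult_iff mult_less_0_iff)
  have minmax: "zeta_min \<mu> lam \<le> zeta_max \<mu> lam" by (simp add: zeta_min_def zeta_max_def)
  have above1: "\<exists>\<zeta>. eigenvalues_above (H_op \<mu> lam) = {complex_of_real \<zeta>} \<and> 2 < \<zeta>" if "p < 0 \<or> p = 0 \<and> 1 < \<mu>"
    using eigenvalues_above_singleton[OF that[unfolded p_def]] joukowski_gt_1 by (metis add_strict_left_mono one_add_one)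
  have below1: "\<exists>\<zeta>. eigenvalues_below (H_op \<mu> lam) = {complex_of_real \<zeta>} \<and> \<zeta> < 0" if "m < 0 \<or> m = 0 \<and> \<mu> < - 1"
    using eigenvalues_below_singleton[OF that[unfolded m_def]] joukowski_gt_1 by (metis diff_less_0_iff_less)
  \<comment> \<open>In the strict case the bound \<open>- 1 < \<mu>\<close> comes from the sign
    condition on \<open>p\<close> by \<open>hyperbola_branches_disjoint\<close>;
    \<open>above0\<close> is the mirror image.\<close>
  have below0: "eigenvalues_below (H_op \<mu> lam) = {}"
    if "m = 0 \<and> - 1 < \<mu> \<or> 0 < m" "p < 0 \<or> p = 0 \<and> 1 < \<mu>"
    using that hyperbola_branches_disjoint[of \<mu> lam] unfolding p_def m_def
    by (intro eigenvalues_below_empty) auto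
  have above0: "eigenvalues_above (H_op \<mu> lam) = {}"
    if "p = 0 \<and> \<mu> < 1 \<or> 0 < p" "m < 0 \<or> m = 0 \<and> \<mu> < - 1"
    using that hyperbola_branches_disjoint[of "- \<mu>" "- lam"] unfolding p_def m_def
    by (intro eigenvalues_above_empty) auto
  have "(\<mu>, lam) \<in> G02 B0 B2 \<Longrightarrow> 0 < p \<and> 1 < \<mu>"
    "(\<mu>, lam) \<in> G20 B0 B2 \<Longrightarrow> 0 < m \<and> \<mu> < - 1"
    "(\<mu>, lam) \<in> G01 B0 B2 \<Longrightarrow> (m = 0 \<and> - 1 < \<mu> \<or> 0 < m) \<and> (p < 0 \<or> p = 0 \<and> 1 < \<mu>)"
    "(\<mu>, lam) \<in> G10 B0 B2 \<Longrightarrow> (p = 0 \<and> \<mu> < 1 \<or> 0 < p) \<and> (m < 0 \<or> m = 0 \<and> \<mu> < - 1)"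
    "(\<mu>, lam) \<in> G11 B0 B2 \<Longrightarrow> (m < 0 \<or> m = 0 \<and> \<mu> < - 1) \<and> (p < 0 \<or> p = 0 \<and> 1 < \<mu>)"
    by (auto simp: G02_def G20_def G01_def G10_def G11_def G2_plus_def G1_plus_def G0_plus_def
        G2_minus_def G1_minus_def G0_minus_def C)
  note G = this
  show ?thesis
  proof (intro conjI impI)
    assume "(\<mu>, lam) \<in> G02 B0 B2"
    then have "0 < \<mu> * lam - \<mu> - lam" "1 < \<mu>" using G(1) by (auto simp: p_def)
    from two_eigenvalues_above[OF this] minmax
    show "eigenvalues_below (H_op \<mu> lam) = {}"
      "\<exists>\<zeta>1 \<zeta>2 :: real. eigenvalues_outside (H_op \<mu> lam) = {complex_of_real \<zeta>1, complex_of_real \<zeta>2} \<and>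
           2 < \<zeta>1 \<and> \<zeta>1 < zeta_min \<mu> lam \<and> zeta_min \<mu> lam \<le> zeta_max \<mu> lam \<and> zeta_max \<mu> lam < \<zeta>2"
      by auto
  next
    assume "(\<mu>, lam) \<in> G20 B0 B2"
    then have "0 < \<mu> * lam + \<mu> + lam" "\<mu> < - 1" using G(2) by (auto simp: m_def)
    from two_eigenvalues_below[OF this] minmax
    show "\<exists>\<zeta>1 \<zeta>2 :: real. eigenvalues_outside (H_op \<mu> lam) = {complex_of_real \<zeta>1, complex_of_real \<zeta>2} \<and>
           \<zeta>1 < zeta_min \<mu> lam \<and> zeta_min \<mu> lam \<le> zeta_max \<mu> lam \<and> zeta_max \<mu> lam < \<zeta>2 \<and> \<zeta>2 < 0"
      "eigenvalues_above (H_op \<mu> lam) = {}"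
      by auto
  next
    assume "(\<mu>, lam) \<in> G01 B0 B2"
    with G(3) below0 above1
    show "eigenvalues_below (H_op \<mu> lam) = {}"
      "\<exists>\<zeta>2 :: real. eigenvalues_outside (H_op \<mu> lam) = {complex_of_real \<zeta>2} \<and> \<zeta>2 > 2"
      by (auto simp: eigenvalues_outside_eq)
  next
    assume "(\<mu>, lam) \<in> G10 B0 B2"
    with G(4) above0 below1
    show "\<exists>\<zeta>1 :: real. eigenvalues_outside (H_op \<mu> lam) = {complex_of_real \<zeta>1} \<and> \<zeta>1 < 0"
      "eigenvalues_above (H_op \<mu> lam) = {}"
      by (auto simp: eigenvalues_outside_eq)
  next
    assume "(\<mu>, lam) \<in> G11 B0 B2"
    with G(5) above1 below1 obtain \<zeta>1 \<zeta>2 where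
      "eigenvalues_below (H_op \<mu> lam) = {complex_of_real \<zeta>1}" "\<zeta>1 < 0"
      "eigenvalues_above (H_op \<mu> lam) = {complex_of_real \<zeta>2}" "2 < \<zeta>2"
      by blast
    then show "\<exists>\<zeta>1 \<zeta>2 :: real. eigenvalues_outside (H_op \<mu> lam) = {complex_of_real \<zeta>1, complex_of_real \<zeta>2} \<and>
        \<zeta>1 < 0 \<and> \<zeta>2 > 2"
      by (intro exI[of _ \<zeta>1] exI[of _ \<zeta>2]) (auto simp: eigenvalues_outside_eq)
  qed
qed

end
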